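(* Let $T,M$ be constant real $n\times n$ matrices and let $Q,c:\mathbb R^n\to\mathbb R$ be such that: (1) $T$ is symmetric positive definite; (2) $M$ is symmetric and invertible; (3) $Q$ and $c$ are $\mathcal C^\infty$; (4) $P:=-\frac{\partial Q}{\partial x}$ vanishes at the origin; (5) $c(x)=0\Leftrightarrow x=0$; (6) $\frac{\partial c}{\partial x}(0)=0$ and $\frac{\partial^2c}{\partial x^2}$ is positive definite. Consider the optimal control problem, with free final time, $$\text{minimize }\int_0^{T_f(u)}c(x)\,dt\quad\text{subject to}\quad \dot x=Tv,\ \ \dot v=P(x)+Mu,\ \ |u_i(t)|\le1\ (i=1,\dots,n),$$ $$(x,v)(0)=(a,b),\qquad (x,v)(T_f(u))=(0,0),$$ where $(x,v)\in\mathbb R^n\times\mathbb R^n$ and $u:[0,T_f(u)]\to\mathbb R^n$ is measurable (the dynamics is that of the Hamiltonian $\frac{v^\intercal Tv}{2}+Q(x)-x^\intercal Mu$). Optimal trajectories may be prolonged after reaching the origin by staying there with $u\equiv0$, at no additional cost. Then, for an optimal trajectory together with its Pontryagin lift: (i) the trajectory is singular on an interval if and only if $(x,v)=(0,0)$ on that interval; (ii) a junction of a nonsingular arc and a singular arc has order $2$ (that is, the problem has order $q=2$ and the corresponding matrix $B$ is nonsingular in a neighborhood of the junction), and this junction is not analytic, so there is Fuller Phenomenon (accumulation of discontinuities of the control) at this junction.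
   Context: Pontryagin lift: an optimal trajectory is considered with $\lambda\in\{0,1\}$ and absolutely continuous $p=(p_1,p_2)$, $(\lambda,p(t))\neq0$, such that for $H=-\lambda c(x)+\langle p_1,Tv\rangle+\langle p_2,P(x)+Mu\rangle$ one has, for almost all $t$, $\dot p_1=-\partial H/\partial x$, $\dot p_2=-\partial H/\partial v$, $H(x(t),v(t),p(t),u(t))=\max\{H(x(t),v(t),p(t),w):|w_i|\le1\}$, and $H(x(t),v(t),p(t),u(t))=0$. Let $\phi=Mp_2$, with components $\phi_i$ (the coefficients of $u_i$ in $H$). The trajectory is singular on an interval (a singular arc) if all $\phi_i$ vanish there; it is nonsingular on an interval (a nonsingular arc) if all $\phi_i$ are nonzero almost everywhere there, in which case $u_i=\operatorname{sign}(\phi_i)$. A junction is a time $t_c$ that is the common endpoint of a singular interval and a nonsingular interval. Order: differentiating $\phi$ repeatedly along extremals, let $k$ be the smallest integer such that $\frac{\partial}{\partial u}\frac{d^k\phi}{dt^k}$ is not identically zero as a function of state and adjoint variables; then the order of the problem is $q=k/2$, and $\frac{d^{2q}\phi}{dt^{2q}}=A+Bu$ with $A,B$ functions of state and adjoint variables. A junction $t_c$ is analytic if the optimal control is piecewise analytic in a neighborhood of $t_c$, where piecewise analytic on $(\alpha,\beta)$ means that for each $s\in(\alpha,\beta)$ there are $t_1\in(\alpha,s)$, $t_2\in(s,\beta)$ such that the control is analytic on $(t_1,s)$ and on $(s,t_2)$. *)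

theory Defs
  imports "HOL-Analysis.Analysis"
begin

section \<open>Calculus notions\<close>

primrec C_k :: "nat \<Rightarrow> ('a::euclidean_space \<Rightarrow> 'b::real_normed_vector) \<Rightarrow> bool" where
  "C_k 0 f \<longleftrightarrow> continuous_on UNIV f"
| "C_k (Suc k) f \<longleftrightarrow>
     (\<forall>x. f differentiable (at x)) \<and> (\<forall>h. C_k k (\<lambda>x. frechet_derivative f (at x) h))"

definition C_infinity :: "('a::euclidean_space \<Rightarrow> 'b::real_normed_vector) \<Rightarrow> bool" where
  "C_infinity f \<longleftrightarrow> (\<forall>k. C_k k f)"

definition grad :: "(real^'n \<Rightarrow> real) \<Rightarrow> real^'n \<Rightarrow> real^'n" where
  "grad f x = (\<chi> i. frechet_derivative f (at x) (axis i 1))"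

definition hessian :: "(real^'n \<Rightarrow> real) \<Rightarrow> real^'n \<Rightarrow> real^'n^'n" where
  "hessian f x = jacobian (grad f) (at x)"

definition positive_definite :: "real^'n^'n \<Rightarrow> bool" where
  "positive_definite A \<longleftrightarrow> (\<forall>w. w \<noteq> 0 \<longrightarrow> w \<bullet> (A *v w) > 0)"

text \<open>
  The usual epsilon-delta notion; a finite family of non-overlapping compact intervals
  is a division of its union, and \<^term>\<open>Inf K\<close>, \<^term>\<open>Sup K\<close> are the endpoints of the
  interval \<^term>\<open>K\<close>.
\<close>
definition abs_continuous_on :: "real set \<Rightarrow> (real \<Rightarrow> 'a::real_normed_vector) \<Rightarrow> bool" where
  "abs_continuous_on S f \<longleftrightarrow>
     (\<forall>\<epsilon>>0. \<exists>\<delta>>0. \<forall>D. D division_of \<Union>D \<and> \<Union>D \<subseteq> S \<and> (\<Sum>K\<in>D. Sup K - Inf K) < \<delta>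
        \<longrightarrow> (\<Sum>K\<in>D. norm (f (Sup K) - f (Inf K))) < \<epsilon>)"

text \<open>Real analyticity; the library's \<open>analytic_on\<close> is complex analyticity.\<close>
definition real_analytic_on :: "(real \<Rightarrow> 'a::real_normed_vector) \<Rightarrow> real set \<Rightarrow> bool" where
  "real_analytic_on f S \<longleftrightarrow>
     (\<forall>s\<in>S. \<exists>r>0. \<exists>a. \<forall>t. \<bar>t - s\<bar> < r \<longrightarrow> (\<lambda>k. (t - s) ^ k *\<^sub>R a k) sums f t)"

definition piecewise_analytic :: "(real \<Rightarrow> 'a::real_normed_vector) \<Rightarrow> real \<Rightarrow> real \<Rightarrow> bool" where
  "piecewise_analytic f \<alpha> \<beta> \<longleftrightarrow>
     (\<forall>s\<in>{\<alpha><..<\<beta>}. \<exists>t\<^sub>1\<in>{\<alpha><..<s}. \<exists>t\<^sub>2\<in>{s<..<\<beta>}.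
        real_analytic_on f {t\<^sub>1<..<s} \<and> real_analytic_on f {s<..<t\<^sub>2})"

section \<open>The optimal control problem\<close>

definition force :: "(real^'n \<Rightarrow> real) \<Rightarrow> real^'n \<Rightarrow> real^'n" where
  "force Q x = - grad Q x"

definition control_box :: "(real^'n) set" where
  "control_box = {w. \<forall>i. \<bar>w $ i\<bar> \<le> 1}"

definition admissible ::
  "real^'n^'n \<Rightarrow> real^'n^'n \<Rightarrow> (real^'n \<Rightarrow> real) \<Rightarrow> real^'n \<Rightarrow> real^'n \<Rightarrow>
   real \<Rightarrow> (real \<Rightarrow> real^'n) \<Rightarrow> (real \<Rightarrow> real^'n) \<Rightarrow> (real \<Rightarrow> real^'n) \<Rightarrow> bool" where
  "admissible T M Q a b T\<^sub>f x v u \<longleftrightarrow>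
     0 \<le> T\<^sub>f \<and>
     u \<in> borel_measurable (lebesgue_on {0..T\<^sub>f}) \<and>
     (\<forall>t\<in>{0..T\<^sub>f}. u t \<in> control_box) \<and>
     abs_continuous_on {0..T\<^sub>f} x \<and> abs_continuous_on {0..T\<^sub>f} v \<and>
     (AE t\<in>{0..T\<^sub>f} in lebesgue.
        (x has_vector_derivative T *v v t) (at t within {0..T\<^sub>f}) \<and>
        (v has_vector_derivative force Q (x t) + M *v u t) (at t within {0..T\<^sub>f})) \<and>
     x 0 = a \<and> v 0 = b \<and> x T\<^sub>f = 0 \<and> v T\<^sub>f = 0"

definition cost :: "(real^'n \<Rightarrow> real) \<Rightarrow> real \<Rightarrow> (real \<Rightarrow> real^'n) \<Rightarrow> real" where
  "cost c T\<^sub>f x = integral {0..T\<^sub>f} (\<lambda>t. c (x t))"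

definition optimal ::
  "real^'n^'n \<Rightarrow> real^'n^'n \<Rightarrow> (real^'n \<Rightarrow> real) \<Rightarrow> (real^'n \<Rightarrow> real) \<Rightarrow> real^'n \<Rightarrow> real^'n \<Rightarrow>
   real \<Rightarrow> (real \<Rightarrow> real^'n) \<Rightarrow> (real \<Rightarrow> real^'n) \<Rightarrow> (real \<Rightarrow> real^'n) \<Rightarrow> bool" where
  "optimal T M Q c a b T\<^sub>f x v u \<longleftrightarrow>
     admissible T M Q a b T\<^sub>f x v u \<and>
     (\<forall>T\<^sub>f' x' v' u'. admissible T M Q a b T\<^sub>f' x' v' u' \<longrightarrow> cost c T\<^sub>f x \<le> cost c T\<^sub>f' x')"

section \<open>Pontryagin lifts\<close>

definition hamiltonian ::
  "real^'n^'n \<Rightarrow> real^'n^'n \<Rightarrow> (real^'n \<Rightarrow> real) \<Rightarrow> (real^'n \<Rightarrow> real) \<Rightarrow> real \<Rightarrow>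
   real^'n \<Rightarrow> real^'n \<Rightarrow> real^'n \<Rightarrow> real^'n \<Rightarrow> real^'n \<Rightarrow> real" where
  "hamiltonian T M Q c l x v p\<^sub>1 p\<^sub>2 u =
     - l * c x + p\<^sub>1 \<bullet> (T *v v) + p\<^sub>2 \<bullet> (force Q x + M *v u)"

definition pontryagin_lift ::
  "real^'n^'n \<Rightarrow> real^'n^'n \<Rightarrow> (real^'n \<Rightarrow> real) \<Rightarrow> (real^'n \<Rightarrow> real) \<Rightarrow>
   real \<Rightarrow> (real \<Rightarrow> real^'n) \<Rightarrow> (real \<Rightarrow> real^'n) \<Rightarrow> (real \<Rightarrow> real^'n) \<Rightarrow>
   real \<Rightarrow> (real \<Rightarrow> real^'n) \<Rightarrow> (real \<Rightarrow> real^'n) \<Rightarrow> bool" where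
  "pontryagin_lift T M Q c S x v u l p\<^sub>1 p\<^sub>2 \<longleftrightarrow>
     l \<in> {0, 1} \<and>
     abs_continuous_on {0..S} p\<^sub>1 \<and> abs_continuous_on {0..S} p\<^sub>2 \<and>
     (\<forall>t\<in>{0..S}. (l, p\<^sub>1 t, p\<^sub>2 t) \<noteq> (0, 0, 0)) \<and>
     (AE t\<in>{0..S} in lebesgue.
        (p\<^sub>1 has_vector_derivative
           - grad (\<lambda>\<xi>. hamiltonian T M Q c l \<xi> (v t) (p\<^sub>1 t) (p\<^sub>2 t) (u t)) (x t))
          (at t within {0..S}) \<and>
        (p\<^sub>2 has_vector_derivative
           - grad (\<lambda>\<eta>. hamiltonian T M Q c l (x t) \<eta> (p\<^sub>1 t) (p\<^sub>2 t) (u t)) (v t))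
          (at t within {0..S}) \<and>
        (\<forall>w\<in>control_box. hamiltonian T M Q c l (x t) (v t) (p\<^sub>1 t) (p\<^sub>2 t) w
                         \<le> hamiltonian T M Q c l (x t) (v t) (p\<^sub>1 t) (p\<^sub>2 t) (u t)) \<and>
        hamiltonian T M Q c l (x t) (v t) (p\<^sub>1 t) (p\<^sub>2 t) (u t) = 0)"

section \<open>Singular arcs, nonsingular arcs and junctions\<close>

definition switching_function :: "real^'n^'n \<Rightarrow> (real \<Rightarrow> real^'n) \<Rightarrow> real \<Rightarrow> real^'n" where
  "switching_function M p\<^sub>2 t = M *v p\<^sub>2 t"

definition singular_on :: "(real \<Rightarrow> real^'n) \<Rightarrow> real set \<Rightarrow> bool" where
  "singular_on \<phi> I \<longleftrightarrow> (\<forall>t\<in>I. \<forall>i. \<phi> t $ i = 0)"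

definition nonsingular_on :: "(real \<Rightarrow> real^'n) \<Rightarrow> real set \<Rightarrow> bool" where
  "nonsingular_on \<phi> I \<longleftrightarrow> (\<forall>i. AE t\<in>I in lebesgue. \<phi> t $ i \<noteq> 0)"

definition junction :: "real \<Rightarrow> (real \<Rightarrow> real^'n) \<Rightarrow> real \<Rightarrow> bool" where
  "junction S \<phi> t\<^sub>c \<longleftrightarrow>
     (\<exists>\<alpha> \<beta>. 0 \<le> \<alpha> \<and> \<alpha> < t\<^sub>c \<and> t\<^sub>c < \<beta> \<and> \<beta> \<le> S \<and>
        (singular_on \<phi> {\<alpha><..<t\<^sub>c} \<and> nonsingular_on \<phi> {t\<^sub>c<..<\<beta>} \<or>
         nonsingular_on \<phi> {\<alpha><..<t\<^sub>c} \<and> singular_on \<phi> {t\<^sub>c<..<\<beta>}))"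

text \<open>
  Controls matter only up to null sets, so analyticity and discontinuity of a control are
  understood modulo modification on a null set.
\<close>

definition analytic_junction :: "(real \<Rightarrow> real^'n) \<Rightarrow> real \<Rightarrow> bool" where
  "analytic_junction u t\<^sub>c \<longleftrightarrow>
     (\<exists>\<epsilon>>0. \<exists>w. (AE t\<in>{t\<^sub>c - \<epsilon><..<t\<^sub>c + \<epsilon>} in lebesgue. w t = u t) \<and>
                piecewise_analytic w (t\<^sub>c - \<epsilon>) (t\<^sub>c + \<epsilon>))"

definition control_discontinuous_at :: "(real \<Rightarrow> real^'n) \<Rightarrow> real \<Rightarrow> bool" where
  "control_discontinuous_at u s \<longleftrightarrow>
     \<not> (\<exists>\<epsilon>>0. \<exists>w. (AE t\<in>{s - \<epsilon><..<s + \<epsilon>} in lebesgue. w t = u t) \<and> isCont w s)"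

definition fuller_phenomenon :: "(real \<Rightarrow> real^'n) \<Rightarrow> real \<Rightarrow> bool" where
  "fuller_phenomenon u t\<^sub>c \<longleftrightarrow> t\<^sub>c islimpt {s. control_discontinuous_at u s}"

section \<open>Order\<close>

type_synonym 'n extremal_point = "(real^'n) \<times> (real^'n) \<times> (real^'n) \<times> (real^'n)"

text \<open>An extremal point is \<open>(x, v, p\<^sub>1, p\<^sub>2)\<close>.\<close>

definition extremal_field ::
  "real^'n^'n \<Rightarrow> real^'n^'n \<Rightarrow> (real^'n \<Rightarrow> real) \<Rightarrow> (real^'n \<Rightarrow> real) \<Rightarrow> real \<Rightarrow>
   'n extremal_point \<Rightarrow> real^'n \<Rightarrow> 'n extremal_point" where
  "extremal_field T M Q c l = (\<lambda>(x, v, p\<^sub>1, p\<^sub>2) u.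
     (T *v v,
      force Q x + M *v u,
      - grad (\<lambda>\<xi>. hamiltonian T M Q c l \<xi> v p\<^sub>1 p\<^sub>2 u) x,
      - grad (\<lambda>\<eta>. hamiltonian T M Q c l x \<eta> p\<^sub>1 p\<^sub>2 u) v))"

text \<open>
  The \<open>k\<close>-th time derivative of \<open>\<phi>\<close> along extremals, as a function of the extremal point and
  of the control. Differentiating with the control held fixed is the total derivative as long
  as the preceding derivatives do not involve the control, i.e. up to and including the first
  \<open>k\<close> at which the control appears; only these \<open>k\<close> are used in the definitions below.
\<close>
primrec switching_deriv ::
  "real^'n^'n \<Rightarrow> real^'n^'n \<Rightarrow> (real^'n \<Rightarrow> real) \<Rightarrow> (real^'n \<Rightarrow> real) \<Rightarrow> real \<Rightarrow>
   nat \<Rightarrow> 'n extremal_point \<Rightarrow> real^'n \<Rightarrow> real^'n" where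
  "switching_deriv T M Q c l 0 = (\<lambda>(x, v, p\<^sub>1, p\<^sub>2) u. M *v p\<^sub>2)"
| "switching_deriv T M Q c l (Suc k) =
     (\<lambda>z u. frechet_derivative (\<lambda>y. switching_deriv T M Q c l k y u) (at z)
              (extremal_field T M Q c l z u))"

definition problem_order ::
  "real^'n^'n \<Rightarrow> real^'n^'n \<Rightarrow> (real^'n \<Rightarrow> real) \<Rightarrow> (real^'n \<Rightarrow> real) \<Rightarrow> real \<Rightarrow> nat \<Rightarrow> bool" where
  "problem_order T M Q c l q \<longleftrightarrow>
     (\<exists>z u. jacobian (switching_deriv T M Q c l (2 * q) z) (at u) \<noteq> 0) \<and>
     (\<forall>j < 2 * q. \<forall>z u. jacobian (switching_deriv T M Q c l j z) (at u) = 0)"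

definition junction_order ::
  "real^'n^'n \<Rightarrow> real^'n^'n \<Rightarrow> (real^'n \<Rightarrow> real) \<Rightarrow> (real^'n \<Rightarrow> real) \<Rightarrow> real \<Rightarrow>
   (real \<Rightarrow> 'n extremal_point) \<Rightarrow> real \<Rightarrow> nat \<Rightarrow> bool" where
  "junction_order T M Q c l z t\<^sub>c q \<longleftrightarrow>
     problem_order T M Q c l q \<and>
     (\<exists>A B. (\<forall>y u. switching_deriv T M Q c l (2 * q) y u = A y + B y *v u) \<and>
            (\<forall>\<^sub>F t in nhds t\<^sub>c. invertible (B (z t))))"

end

theory Submission
  imports Defs
begin

text \<open>
  On a singular arc \<open>\<phi> = M p\<^sub>2\<close> vanishes, hence so do \<open>p\<^sub>1\<close> (as \<open>p\<^sub>2' = - T p\<^sub>1\<close>) and \<open>l \<nabla>c(x)\<close>;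
  nontriviality forces \<open>l = 1\<close>, strict convexity of \<open>c\<close> forces \<open>x = 0\<close>, and then \<open>v = 0\<close>. Conversely,
  resting at the origin needs \<open>u = 0\<close>, which maximizes \<open>\<phi> \<bullet> u\<close> over the box only if \<open>\<phi> = 0\<close>.

  So at a junction the extremal is at the origin, where the first three derivatives of \<open>\<phi>\<close> vanish
  and the fourth is \<open>B u\<close> with \<open>B = - M T c''(0) T M\<close> negative definite. On the nonsingular side
  \<open>u\<^sub>i = sgn \<phi>\<^sub>i\<close>. If \<open>u\<close> had no discontinuity in a one-sided neighborhood of the junction, it would be
  a constant \<open>w\<close> there, with \<open>w \<bullet> \<phi> \<ge> 0\<close>; but \<open>w \<bullet> \<phi>\<close> behaves like \<open>(w \<bullet> B w) (t - t\<^sub>c)\<^sup>4 / 24 < 0\<close>.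
  Discontinuities therefore accumulate at the junction, which also rules out analyticity.
\<close>

section \<open>Absolutely continuous functions and the fundamental theorem of calculus\<close>

text \<open>Non-overlapping intervals inside \<open>U\<close> have total length at most the measure
  of \<open>U\<close>, so smallness of \<open>U\<close> supplies what the definition asks of the
  untagged division. Tagged families are the form that the gauge integral produces.\<close>

lemma abs_continuous_on_tagged_partial_division:
  fixes f :: "real \<Rightarrow> 'a::real_normed_vector"
  assumes ac: "abs_continuous_on {a..b} f" and "0 < \<epsilon>"
  obtains \<delta> where "0 < \<delta>"
    "\<And>p U. p tagged_partial_division_of {a..b} \<Longrightarrow> (\<And>t K. (t, K) \<in> p \<Longrightarrow> K \<subseteq> U) \<Longrightarrow>
       U \<in> lmeasurable \<Longrightarrow> measure lebesgue U < \<delta> \<Longrightarrow>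
       (\<Sum>(t, K)\<in>p. norm (f (Sup K) - f (Inf K))) < \<epsilon>"
proof -
  obtain \<delta> where "0 < \<delta>" and \<delta>: "\<And>D. D division_of \<Union>D \<Longrightarrow> \<Union>D \<subseteq> {a..b} \<Longrightarrow>
      (\<Sum>K\<in>D. Sup K - Inf K) < \<delta> \<Longrightarrow> (\<Sum>K\<in>D. norm (f (Sup K) - f (Inf K))) < \<epsilon>"
    using ac \<open>0 < \<epsilon>\<close> unfolding abs_continuous_on_def by meson
  have "(\<Sum>(t, K)\<in>p. norm (f (Sup K) - f (Inf K))) < \<epsilon>"
    if p: "p tagged_partial_division_of {a..b}" and sub: "\<And>t K. (t, K) \<in> p \<Longrightarrow> K \<subseteq> U"
      and U: "U \<in> lmeasurable" "measure lebesgue U < \<delta>" for p U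
  proof -
    let ?D = "snd ` p"
    have D: "?D division_of \<Union>?D"
      using p by (rule partial_division_of_tagged_division)
    have "\<Union>?D \<subseteq> {a..b}"
      using tagged_partial_division_ofD(3)[OF p] by fastforce
    have "\<Union>?D \<subseteq> U"
      using sub by (simp add: UN_least split_paired_all)
    have len: "Sup K - Inf K = measure lebesgue K" if "K \<in> ?D" for K
    proof -
      have "K \<noteq> {}" "\<exists>c d. K = cbox c d"
        using division_ofD(3,4)[OF D] that by auto
      then show ?thesis
        by (auto simp: box_real)
    qed
    have "(\<Sum>K\<in>?D. Sup K - Inf K) = measure lebesgue (\<Union>?D)"
      using content_division[OF D] len by simp
    also have "\<dots> \<le> measure lebesgue U"
      using lmeasurable_division[OF D] U(1) \<open>\<Union>?D \<subseteq> U\<close>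
      by (intro measure_mono_fmeasurable) (auto simp: fmeasurableD)
    finally have "(\<Sum>K\<in>?D. norm (f (Sup K) - f (Inf K))) < \<epsilon>"
      using U D \<open>\<Union>?D \<subseteq> {a..b}\<close> by (intro \<delta>) auto
    moreover
    \<comment> \<open>Two tags can share an interval only if its interior is empty; then its
      endpoints agree and the increment is 0, so forgetting tags keeps the sum. The value on the
      empty set is fixed by hand because its \<open>Sup\<close> and \<open>Inf\<close> carry no
      information.\<close>
    let ?d = "\<lambda>K. if K = {} then 0 else norm (f (Sup K) - f (Inf K))"
    have "(\<Sum>(t, K)\<in>p. ?d K) = sum ?d ?D"
      by (rule sum.over_tagged_division_lemma[OF tagged_partial_division_of_Union_self[OF p]])
         (auto simp: box_real)
    moreover have "(\<Sum>(t, K)\<in>p. ?d K) = (\<Sum>(t, K)\<in>p. norm (f (Sup K) - f (Inf K)))"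
      using tagged_partial_division_ofD(2)[OF p] by (intro sum.cong refl) force
    moreover have "sum ?d ?D = (\<Sum>K\<in>?D. norm (f (Sup K) - f (Inf K)))"
      using division_ofD(3)[OF D] by (intro sum.cong) auto
    ultimately show ?thesis
      by simp
  qed
  with \<open>0 < \<delta>\<close> that show ?thesis
    by blast
qed

text \<open>Gauge argument: at tags where the derivative exists it approximates the increments of
  \<open>f\<close>, and over intervals tagged in the exceptional null set the increments are small
  by absolute continuity.\<close>

lemma abs_continuous_on_has_integral:
  fixes f :: "real \<Rightarrow> 'a::banach"
  assumes ac: "abs_continuous_on {a..b} f" and "a \<le> b"
    and deriv: "AE t\<in>{a..b} in lebesgue. (f has_vector_derivative g t) (at t within {a..b})"
  shows "(g has_integral f b - f a) {a..b}"
proof (cases "a = b")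
  case True
  then show ?thesis
    using has_integral_refl(2)[of g a] by simp
next
  case False
  with \<open>a \<le> b\<close> have "a < b" by simp
  define N where "N = {t\<in>{a..b}. \<not> (f has_vector_derivative g t) (at t within {a..b})}"
  have "negligible N"
    using deriv unfolding eventually_ae_filter_negligible
    by (auto simp: N_def elim!: negligible_subset)
  \<comment> \<open>A change on a null set does not affect the integral. With the value 0 there,
    intervals tagged in \<open>N\<close> contribute only increments of \<open>f\<close>.\<close>
  define h where "h t = (if t \<in> N then 0 else g t)" for t
  have "(h has_integral f b - f a) {a..b}"
    unfolding has_integral_factor_content_real
  proof (intro allI impI)
    fix e :: real assume "e > 0"
    \<comment> \<open>Half of the error is spent on tags in \<open>N\<close>, half on the
      others.\<close>
    define \<epsilon> where "\<epsilon> = e / 2"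
    have "\<epsilon> > 0" and "\<epsilon> * (b - a) > 0"
      using \<open>e > 0\<close> \<open>a < b\<close> by (auto simp: \<epsilon>_def)
    obtain \<delta> where "\<delta> > 0" and \<delta>:
      "\<And>p U. p tagged_partial_division_of {a..b} \<Longrightarrow> (\<And>t K. (t, K) \<in> p \<Longrightarrow> K \<subseteq> U) \<Longrightarrow>
         U \<in> lmeasurable \<Longrightarrow> measure lebesgue U < \<delta> \<Longrightarrow>
         (\<Sum>(t, K)\<in>p. norm (f (Sup K) - f (Inf K))) < \<epsilon> * (b - a)"
      by (rule abs_continuous_on_tagged_partial_division[OF ac \<open>\<epsilon> * (b - a) > 0\<close>]) (rule that; blast)
    have "N \<in> sets lebesgue"
      using \<open>negligible N\<close> by (simp add: negligible_imp_sets)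
    then obtain U where U: "open U" "N \<subseteq> U" "U - N \<in> lmeasurable"
        "emeasure lebesgue (U - N) < ennreal \<delta>"
      using sets_lebesgue_outer_open \<open>\<delta> > 0\<close> by blast
    have U': "U \<in> lmeasurable \<and> measure lebesgue U < \<delta>"
    proof -
      have eq: "U = (U - N) \<union> N"
        using U by auto
      have N0: "N \<in> lmeasurable" "measure lebesgue N = 0"
        using \<open>negligible N\<close> by (auto simp: negligible_imp_measurable negligible_imp_measure0)
      have "U \<in> lmeasurable"
        using U(3) N0(1) eq by (metis fmeasurable.Un)
      moreover have "measure lebesgue U \<le> measure lebesgue (U - N) + measure lebesgue N"
        by (subst eq) (rule measure_Un_le; use U(3) N0(1) in \<open>auto simp: fmeasurableD\<close>)
      moreover have "measure lebesgue (U - N) < \<delta>"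
        using U(3,4) \<open>\<delta> > 0\<close> by (simp add: emeasure_eq_measure2 ennreal_less_iff)
      ultimately show ?thesis
        using N0 by simp
    qed
    have "\<exists>r>0. \<forall>y\<in>{a..b}. \<bar>y - t\<bar> < r \<longrightarrow> norm (f y - f t - (y - t) *\<^sub>R g t) \<le> \<epsilon> * \<bar>y - t\<bar>"
      if "t \<in> {a..b} - N" for t
    proof -
      have "(f has_vector_derivative g t) (at t within {a..b})"
        using that by (auto simp: N_def)
      then show ?thesis
        using \<open>\<epsilon> > 0\<close> unfolding has_vector_derivative_def has_derivative_within_alt
        by (simp; metis)
    qed
    then obtain r where r: "\<And>t. t \<in> {a..b} - N \<Longrightarrow> r t > 0"
      "\<And>t y. t \<in> {a..b} - N \<Longrightarrow> y \<in> {a..b} \<Longrightarrow> \<bar>y - t\<bar> < r t \<Longrightarrow>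
         norm (f y - f t - (y - t) *\<^sub>R g t) \<le> \<epsilon> * \<bar>y - t\<bar>"
      by metis
    \<comment> \<open>For tags in \<open>N\<close> the gauge \<open>U\<close> keeps the intervals
      within measure \<open>\<delta>\<close>; other tags get the radius of linear approximation.
      Points outside \<open>{a..b}\<close> are never tags and only need some open
      neighborhood.\<close>
    define d where "d t = (if t \<in> N then U else if t \<in> {a..b} then ball t (r t) else UNIV)" for t
    have "gauge d"
      using U r by (auto simp: gauge_def d_def)
    moreover have "norm ((\<Sum>(x, k)\<in>p. measure lborel k *\<^sub>R h x) - (f b - f a)) \<le> e * measure lborel {a..b}"
      if p: "p tagged_division_of {a..b}" "d fine p" for p
    proof -
      have fin: "finite p"
        using p(1) by auto
      define q where "q = {(t, K) \<in> p. t \<in> N}"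
      have "q \<subseteq> p"
        by (auto simp: q_def)
      have K: "\<exists>c d. K = {c..d} \<and> c \<le> t \<and> t \<le> d \<and> a \<le> c \<and> d \<le> b" if tK: "(t, K) \<in> p" for t K
      proof -
        obtain c d where "K = cbox c d"
          using tagged_division_ofD(4)[OF p(1) tK] by blast
        moreover have "t \<in> K" "K \<subseteq> {a..b}"
          using tagged_division_ofD(2,3)[OF p(1) tK] by auto
        ultimately show ?thesis
          by (auto simp: box_real intro!: exI)
      qed
      have q: "(\<Sum>(t, K)\<in>q. norm (f (Sup K) - f (Inf K))) < \<epsilon> * (b - a)"
      proof (rule \<delta>)
        show "q tagged_partial_division_of {a..b}"
          using p(1) tagged_partial_division_subset[OF _ \<open>q \<subseteq> p\<close>] unfolding tagged_division_of_def by simp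
        show "K \<subseteq> U" if "(t, K) \<in> q" for t K
          using fineD[OF p(2), of t K] that by (simp add: q_def d_def)
      qed (use U' in simp_all)
      \<comment> \<open>Both endpoints are compared with the tag; the two linear terms combine to
        the length of \<open>K\<close> times \<open>g t\<close>.\<close>
      have pq: "norm (measure lborel K *\<^sub>R h t - (f (Sup K) - f (Inf K))) \<le> \<epsilon> * measure lborel K"
        if tK: "(t, K) \<in> p - q" for t K
      proof -
        obtain c d' where cd: "K = {c..d'}" "c \<le> t" "t \<le> d'" "a \<le> c" "d' \<le> b"
          using K tK by blast
        have t: "t \<in> {a..b} - N"
          using that cd by (auto simp: q_def)
        then have ball: "K \<subseteq> ball t (r t)"
          using fineD[OF p(2), of t K] tK by (simp add: d_def)
        have near: "\<bar>c - t\<bar> < r t" "\<bar>d' - t\<bar> < r t"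
          using cd subsetD[OF ball, of c] subsetD[OF ball, of d'] by (auto simp: dist_real_def)
        have "norm (f d' - f t - (d' - t) *\<^sub>R g t) \<le> \<epsilon> * (d' - t)"
          "norm (f c - f t - (c - t) *\<^sub>R g t) \<le> \<epsilon> * (t - c)"
          using r(2)[OF t, of d'] r(2)[OF t, of c] near cd t by auto
        then have "norm ((f c - f t - (c - t) *\<^sub>R g t) - (f d' - f t - (d' - t) *\<^sub>R g t)) \<le> \<epsilon> * (t - c) + \<epsilon> * (d' - t)"
          by (intro norm_triangle_le_diff) linarith
        moreover have "h t = g t"
          using t by (simp add: h_def)
        ultimately show ?thesis
          using cd by (simp add: algebra_simps)
      qed
      have "(\<Sum>(x, k)\<in>p. measure lborel k *\<^sub>R h x) - (f b - f a)
          = (\<Sum>(t, K)\<in>p. measure lborel K *\<^sub>R h t - (f (Sup K) - f (Inf K)))"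
        unfolding additive_tagged_division_1[OF \<open>a \<le> b\<close> p(1), symmetric] sum_subtractf[symmetric]
        by (simp add: case_prod_beta)
      also have "norm \<dots> \<le> (\<Sum>(t, K)\<in>p. norm (measure lborel K *\<^sub>R h t - (f (Sup K) - f (Inf K))))"
        by (simp add: case_prod_beta sum_norm_le)
      also have "\<dots> = (\<Sum>(t, K)\<in>p - q. norm (measure lborel K *\<^sub>R h t - (f (Sup K) - f (Inf K))))
          + (\<Sum>(t, K)\<in>q. norm (measure lborel K *\<^sub>R h t - (f (Sup K) - f (Inf K))))"
        by (rule sum.subset_diff[OF \<open>q \<subseteq> p\<close> fin])
      also have "(\<Sum>(t, K)\<in>q. norm (measure lborel K *\<^sub>R h t - (f (Sup K) - f (Inf K))))
          = (\<Sum>(t, K)\<in>q. norm (f (Sup K) - f (Inf K)))"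
        by (intro sum.cong) (auto simp: q_def h_def norm_minus_commute)
      also have "(\<Sum>(t, K)\<in>p - q. norm (measure lborel K *\<^sub>R h t - (f (Sup K) - f (Inf K))))
          \<le> (\<Sum>(t, K)\<in>p - q. \<epsilon> * measure lborel K)"
        using pq by (intro sum_mono) auto
      also have "\<dots> \<le> (\<Sum>(t, K)\<in>p. \<epsilon> * measure lborel K)"
        using fin \<open>\<epsilon> > 0\<close> by (intro sum_mono2) auto
      also have "\<dots> = \<epsilon> * (b - a)"
        using additive_content_tagged_division[of p a b] p(1) \<open>a \<le> b\<close>
        by (simp add: sum_distrib_left[symmetric] case_prod_beta)
      finally show ?thesis
        using q \<open>a \<le> b\<close> by (simp add: \<epsilon>_def)
    qed
    ultimately show "\<exists>d. gauge d \<and> (\<forall>p. p tagged_division_of {a..b} \<and> d fine p \<longrightarrow>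
        norm ((\<Sum>(x, k)\<in>p. measure lborel k *\<^sub>R h x) - (f b - f a)) \<le> e * measure lborel {a..b})"
      by (intro exI[of _ d]) simp
  qed
  then show ?thesis
    by (rule has_integral_spike[OF \<open>negligible N\<close>, rotated]) (simp add: h_def)
qed

lemma abs_continuous_on_subset:
  "abs_continuous_on S f \<Longrightarrow> R \<subseteq> S \<Longrightarrow> abs_continuous_on R f"
  unfolding abs_continuous_on_def by (meson order_trans)

lemma abs_continuous_on_imp_continuous_on:
  fixes f :: "real \<Rightarrow> 'a::real_normed_vector"
  assumes ac: "abs_continuous_on {a..b} f"
  shows "continuous_on {a..b} f"
  unfolding continuous_on_iff
proof (intro ballI allI impI)
  fix s \<epsilon> :: real assume s: "s \<in> {a..b}" and "0 < \<epsilon>"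
  then obtain \<delta> where "0 < \<delta>" and \<delta>: "\<And>D. D division_of \<Union>D \<Longrightarrow> \<Union>D \<subseteq> {a..b} \<Longrightarrow>
      (\<Sum>K\<in>D. Sup K - Inf K) < \<delta> \<Longrightarrow> (\<Sum>K\<in>D. norm (f (Sup K) - f (Inf K))) < \<epsilon>"
    using ac unfolding abs_continuous_on_def by meson
  \<comment> \<open>A single interval is already a division, so the definition bounds one
    increment.\<close>
  have "norm (f d - f c) < \<epsilon>" if "c \<le> d" "c \<in> {a..b}" "d \<in> {a..b}" "d - c < \<delta>" for c d
    using \<delta>[of "{{c..d}}"] division_of_self[of c d] that by (simp add: box_real)
  with s \<open>0 < \<delta>\<close> show "\<exists>d>0. \<forall>t\<in>{a..b}. dist t s < d \<longrightarrow> dist (f t) (f s) < \<epsilon>"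
    by (intro exI[of _ \<delta>]) (auto simp: dist_norm, metis abs_minus_commute atLeastAtMost_iff
        abs_less_iff linorder_linear minus_diff_eq norm_minus_commute)
qed

text \<open>\<open>f\<close> is the integral of its almost-everywhere derivative \<open>g\<close>,
  and the integral of a continuous function is differentiable at every time, one-sidedly at the
  endpoints.\<close>

lemma abs_continuous_on_has_vector_derivative:
  fixes f :: "real \<Rightarrow> 'a::banach"
  assumes ac: "abs_continuous_on {a..b} f" and g: "continuous_on {a..b} g"
    and deriv: "AE t\<in>{a<..<b} in lebesgue. (f has_vector_derivative g t) (at t)"
    and t: "t \<in> {a..b}"
  shows "(f has_vector_derivative g t) (at t within {a..b})"
proof -
  have "AE t in lebesgue. t \<noteq> a" "AE t in lebesgue. t \<noteq> b"
    by (auto intro!: AE_lborel_singleton AE_completion)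
  with deriv have ae: "AE t\<in>{a..b} in lebesgue. (f has_vector_derivative g t) (at t)"
    by eventually_elim auto
  have f: "f s = f a + integral {a..s} g" if "s \<in> {a..b}" for s
  proof -
    have "(g has_integral f s - f a) {a..s}"
    proof (rule abs_continuous_on_has_integral)
      show "abs_continuous_on {a..s} f"
        using ac that by (auto elim: abs_continuous_on_subset)
      show "AE t\<in>{a..s} in lebesgue. (f has_vector_derivative g t) (at t within {a..s})"
        using ae that by (auto elim!: eventually_mono intro: has_vector_derivative_at_within)
    qed (use that in auto)
    then show ?thesis
      by (simp add: integral_unique)
  qed
  have "((\<lambda>s. f a + integral {a..s} g) has_vector_derivative g t) (at t within {a..b})"
    using integral_has_vector_derivative[OF g t]
    by (auto intro: derivative_eq_intros)
  then show ?thesis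
    using has_vector_derivative_transform[OF t f] by simp
qed

section \<open>Derivatives of smooth functions and of matrix products\<close>

text \<open>Scalar-valued, unlike \<open>grad\<close>, so that it can be iterated and stays within
  \<open>C_infinity\<close>; third-order partials of \<open>Q\<close> are reached this way.\<close>

definition partial_deriv :: "(real^'n \<Rightarrow> real) \<Rightarrow> 'n \<Rightarrow> real^'n \<Rightarrow> real" where
  "partial_deriv f i x = frechet_derivative f (at x) (axis i 1)"

lemma C_infinity_partial_deriv:
  assumes "C_infinity f"
  shows "C_infinity (partial_deriv f i)"
  unfolding C_infinity_def
proof
  fix k
  have "C_k (Suc k) f"
    using assms by (simp only: C_infinity_def)
  then show "C_k k (partial_deriv f i)"
    by (simp add: partial_deriv_def[abs_def])
qed

lemma C_infinity_has_derivative: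
  fixes f :: "real^'n \<Rightarrow> real"
  assumes "C_infinity f"
  shows "(f has_derivative (\<lambda>h. \<Sum>i\<in>UNIV. h $ i * partial_deriv f i x)) (at x)"
proof -
  have "C_k (Suc 0) f"
    using assms by (simp only: C_infinity_def)
  then have D: "(f has_derivative frechet_derivative f (at x)) (at x)"
    by (simp add: frechet_derivative_works)
  have "frechet_derivative f (at x) h = (\<Sum>i\<in>UNIV. h $ i * partial_deriv f i x)" for h
  proof -
    have "frechet_derivative f (at x) (\<Sum>i\<in>UNIV. h $ i *\<^sub>R axis i 1)
        = (\<Sum>i\<in>UNIV. h $ i * partial_deriv f i x)"
      using has_derivative_linear[OF D]
      by (simp add: linear_sum linear_cmul partial_deriv_def)
    then show ?thesis
      using basis_expansion[of h] by (simp add: scalar_mult_eq_scaleR)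
  qed
  then have "frechet_derivative f (at x) = (\<lambda>h. \<Sum>i\<in>UNIV. h $ i * partial_deriv f i x)"
    by (rule ext)
  with D show ?thesis
    by simp
qed

lemma C_infinity_continuous_on: "C_infinity f \<Longrightarrow> continuous_on S f"
  using C_k.simps(1) continuous_on_subset unfolding C_infinity_def by blast

lemma has_derivative_vec:
  fixes f :: "'a::real_normed_vector \<Rightarrow> real^'n"
  assumes "\<And>i. ((\<lambda>x. f x $ i) has_derivative (\<lambda>h. f' h $ i)) (at a within S)"
  shows "(f has_derivative f') (at a within S)"
  unfolding has_derivative_componentwise_within[of f]
  using assms by (auto simp: Basis_vec_def inner_axis)

lemma has_derivative_matrix_vector_mult:
  fixes A :: "'a::real_normed_vector \<Rightarrow> real^'n^'m" and f :: "'a \<Rightarrow> real^'n"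
  assumes "\<And>i j. ((\<lambda>x. A x $ i $ j) has_derivative (\<lambda>h. A' h $ i $ j)) (at a)"
    and f: "(f has_derivative f') (at a)"
  shows "((\<lambda>x. A x *v f x) has_derivative (\<lambda>h. A' h *v f a + A a *v f' h)) (at a)"
proof (rule has_derivative_vec)
  fix i
  have "((\<lambda>x. \<Sum>j\<in>UNIV. A x $ i $ j * f x $ j) has_derivative
      (\<lambda>h. \<Sum>j\<in>UNIV. A a $ i $ j * f' h $ j + A' h $ i $ j * f a $ j)) (at a)"
    by (intro has_derivative_sum has_derivative_mult assms
        bounded_linear.has_derivative[OF bounded_linear_vec_nth f])
  then show "((\<lambda>x. (A x *v f x) $ i) has_derivative (\<lambda>h. (A' h *v f a + A a *v f' h) $ i)) (at a)"
    by (simp add: matrix_vector_mult_def sum.distrib add.commute)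
qed

lemma differentiable_matrix_vector_mult:
  fixes A :: "'a::real_normed_vector \<Rightarrow> real^'n^'m" and f :: "'a \<Rightarrow> real^'n"
  assumes A: "\<And>i j. (\<lambda>x. A x $ i $ j) differentiable (at a)" and f: "f differentiable (at a)"
  shows "(\<lambda>x. A x *v f x) differentiable (at a)"
proof -
  obtain A' where "\<And>i j. ((\<lambda>x. A x $ i $ j) has_derivative A' i j) (at a)"
    using A unfolding differentiable_def by metis
  then have "((\<lambda>x. A x *v f x) has_derivative
      (\<lambda>h. (\<chi> i j. A' i j h) *v f a + A a *v frechet_derivative f (at a) h)) (at a)"
    by (intro has_derivative_matrix_vector_mult) (simp_all add: f[unfolded frechet_derivative_works])
  then show ?thesis
    by (rule differentiableI)
qed

text \<open>By the chain rule the derivative in direction \<open>e\<close> is the slope along the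
  line. This reads off one directional derivative without a formula for the whole
  derivative.\<close>

lemma frechet_derivative_along_line:
  fixes f :: "'a::real_normed_vector \<Rightarrow> 'b::real_normed_vector"
  assumes f: "f differentiable (at z)" and line: "\<And>s. f (z + s *\<^sub>R e) = f z + s *\<^sub>R d"
  shows "frechet_derivative f (at z) e = d"
proof -
  have "((\<lambda>s::real. z + s *\<^sub>R e) has_derivative (\<lambda>s. s *\<^sub>R e)) (at 0)"
    by (auto intro!: derivative_eq_intros)
  then have "((\<lambda>s::real. f (z + s *\<^sub>R e)) has_derivative (\<lambda>s. frechet_derivative f (at z) (s *\<^sub>R e))) (at 0)"
    by (rule has_derivative_compose) (use f[unfolded frechet_derivative_works] in simp)
  moreover have "((\<lambda>s::real. f (z + s *\<^sub>R e)) has_derivative (\<lambda>s. s *\<^sub>R d)) (at 0)"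
    unfolding line by (auto intro!: derivative_eq_intros)
  ultimately have "(\<lambda>s::real. frechet_derivative f (at z) (s *\<^sub>R e)) = (\<lambda>s. s *\<^sub>R d)"
    by (rule has_derivative_unique)
  from fun_cong[OF this, of 1] show ?thesis
    by simp
qed

section \<open>Matrices, gradients and Hessians\<close>

lemma positive_definite_imp_invertible:
  fixes A :: "real^'n^'n"
  assumes "positive_definite A"
  shows "invertible A"
  unfolding invertible_left_inverse matrix_left_invertible_ker
  using assms unfolding positive_definite_def by (metis inner_zero_right less_irrefl)

lemma symmetric_matrix_inner:
  fixes A :: "real^'n^'n"
  assumes "transpose A = A"
  shows "(A *v x) \<bullet> y = x \<bullet> (A *v y)"
  by (metis assms dot_lmul_matrix vector_transpose_matrix)

lemma invertible_matrix_vector_eq_0_iff: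
  fixes A :: "real^'n^'n"
  assumes "invertible A"
  shows "A *v x = 0 \<longleftrightarrow> x = 0"
  using assms matrix_left_invertible_ker[of A] by (auto simp: invertible_left_inverse)

lemma matrix_vector_mult_minus: "A *v (- x) = - (A *v x)" for A :: "real^'n^'m"
  using matrix_vector_mult_diff_distrib[of A 0 x] by simp

lemma matrix_vector_mult_uminus: "(- A) *v x = - (A *v x)" for A :: "real^'n^'m"
  by (simp add: matrix_vector_mult_def vec_eq_iff sum_negf)

lemma grad_eq: "grad f x = (\<chi> i. partial_deriv f i x)"
  by (simp add: grad_def partial_deriv_def)

lemma gradI:
  assumes "(f has_derivative (\<lambda>h. g \<bullet> h)) (at x)"
  shows "grad f x = g"
  using fun_cong[OF frechet_derivative_at[OF assms], symmetric]
  by (simp add: grad_def vec_eq_iff inner_axis)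

lemma hessian_eq:
  fixes f :: "real^'n \<Rightarrow> real"
  assumes "C_infinity f"
  shows "hessian f x = (\<chi> i j. partial_deriv (partial_deriv f i) j x)"
proof -
  have "(grad f has_derivative (\<lambda>h. (\<chi> i j. partial_deriv (partial_deriv f i) j x) *v h)) (at x)"
    unfolding grad_eq[abs_def]
    by (rule has_derivative_vec)
      (use C_infinity_has_derivative[OF C_infinity_partial_deriv[OF assms], of _ x]
        in \<open>simp add: matrix_vector_mult_def mult.commute\<close>)
  from frechet_derivative_at[OF this] show ?thesis
    unfolding hessian_def jacobian_def by (metis matrix_of_matrix_vector_mul)
qed

text \<open>Positive definiteness of the Hessian makes the slope of \<open>f\<close> along the ray
  through \<open>x\<close> strictly increasing. It is 0 at the origin, so a second zero at
  \<open>x\<close> contradicts the mean value theorem.\<close>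

lemma grad_eq_0_iff:
  fixes f :: "real^'n \<Rightarrow> real"
  assumes f: "C_infinity f" and "grad f 0 = 0" and "\<And>y. positive_definite (hessian f y)"
  shows "grad f x = 0 \<longleftrightarrow> x = 0"
proof
  assume x: "grad f x = 0"
  show "x = 0"
  proof (rule ccontr)
    assume "x \<noteq> 0"
    let ?F = "\<lambda>s::real. grad f (s *\<^sub>R x) \<bullet> x"
    have "(?F has_real_derivative (hessian f (s *\<^sub>R x) *v x) \<bullet> x) (at s)" for s
    proof -
      have "((\<lambda>s. partial_deriv f i (s *\<^sub>R x)) has_real_derivative
          (hessian f (s *\<^sub>R x) *v x) $ i) (at s)" for i
      proof -
        have "((\<lambda>s::real. s *\<^sub>R x) has_derivative (\<lambda>h. h *\<^sub>R x)) (at s)"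
          by (auto intro!: derivative_eq_intros)
        from has_derivative_compose[OF this
            C_infinity_has_derivative[OF C_infinity_partial_deriv[OF f], of i "s *\<^sub>R x"]]
        show ?thesis
          by (rule has_derivative_imp_has_field_derivative)
            (simp add: hessian_eq[OF f] matrix_vector_mult_def sum_distrib_left mult_ac)
      qed
      then have "((\<lambda>s. \<Sum>i\<in>UNIV. partial_deriv f i (s *\<^sub>R x) * x $ i) has_real_derivative
          (\<Sum>i\<in>UNIV. (hessian f (s *\<^sub>R x) *v x) $ i * x $ i)) (at s)"
        by (intro DERIV_sum DERIV_cmult_right)
      then show ?thesis
        by (simp add: inner_vec_def grad_eq)
    qed
    from MVT2[OF zero_less_one this]
    obtain s where "?F 1 - ?F 0 = (1 - 0) * ((hessian f (s *\<^sub>R x) *v x) \<bullet> x)"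
      by auto
    with x assms(2) have "x \<bullet> (hessian f (s *\<^sub>R x) *v x) = 0"
      by (simp add: inner_commute)
    with assms(3) \<open>x \<noteq> 0\<close> show False
      unfolding positive_definite_def by (metis less_irrefl)
  qed
qed (use assms in simp)

section \<open>The Hamiltonian vector field and its derivatives\<close>

text \<open>
  The adjoint equation reads \<open>p\<^sub>1' = l *\<^sub>R grad c x + force_hessian Q x *v p\<^sub>2\<close>;
  \<open>adjoint_jacobian\<close> is the derivative of its right-hand side in \<open>x\<close>.
\<close>
definition force_hessian :: "(real^'n \<Rightarrow> real) \<Rightarrow> real^'n \<Rightarrow> real^'n^'n" where
  "force_hessian Q x = (\<chi> i k. partial_deriv (partial_deriv Q k) i x)"

definition adjoint_jacobian ::
  "(real^'n \<Rightarrow> real) \<Rightarrow> (real^'n \<Rightarrow> real) \<Rightarrow> real \<Rightarrow> real^'n \<Rightarrow> real^'n \<Rightarrow> real^'n^'n" where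
  "adjoint_jacobian Q c l x q =
     (\<chi> i j. l * partial_deriv (partial_deriv c i) j x
            + (\<Sum>k\<in>UNIV. q $ k * partial_deriv (partial_deriv (partial_deriv Q k) i) j x))"

text \<open>Velocity and control terms are constant in the position. The minus sign in
  \<open>force\<close> cancels the one of the adjoint equation, so the Hessian of \<open>Q\<close>
  appears with a plus.\<close>

lemma grad_hamiltonian_x:
  assumes Q: "C_infinity Q" and c: "C_infinity c"
  shows "- grad (\<lambda>\<xi>. hamiltonian T M Q c l \<xi> v p\<^sub>1 p\<^sub>2 u) x = l *\<^sub>R grad c x + force_hessian Q x *v p\<^sub>2"
proof -
  note D = C_infinity_has_derivative[OF c, of x]
    C_infinity_has_derivative[OF C_infinity_partial_deriv[OF Q], of _ x]
  have "((\<lambda>\<xi>. - l * c \<xi> + p\<^sub>1 \<bullet> (T *v v) +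
        (\<Sum>k\<in>UNIV. p\<^sub>2 $ k * (- partial_deriv Q k \<xi> + (M *v u) $ k))) has_derivative
      (\<lambda>h. - l * (\<Sum>i\<in>UNIV. h $ i * partial_deriv c i x) + 0 +
        (\<Sum>k\<in>UNIV. p\<^sub>2 $ k * (- (\<Sum>i\<in>UNIV. h $ i * partial_deriv (partial_deriv Q k) i x) + 0)))) (at x)"
    by (intro has_derivative_add has_derivative_const has_derivative_mult_right has_derivative_sum
        has_derivative_minus D)
  moreover have "- l * (\<Sum>i\<in>UNIV. h $ i * partial_deriv c i x) + 0 +
        (\<Sum>k\<in>UNIV. p\<^sub>2 $ k * (- (\<Sum>i\<in>UNIV. h $ i * partial_deriv (partial_deriv Q k) i x) + 0))
      = - (l *\<^sub>R grad c x + force_hessian Q x *v p\<^sub>2) \<bullet> h" for h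
  proof -
    have "(\<Sum>k\<in>UNIV. p\<^sub>2 $ k * (\<Sum>i\<in>UNIV. h $ i * partial_deriv (partial_deriv Q k) i x))
       = (force_hessian Q x *v p\<^sub>2) \<bullet> h"
      unfolding force_hessian_def inner_vec_def matrix_vector_mult_def sum_distrib_left
      by (subst sum.swap) (simp add: sum_distrib_left mult_ac)
    moreover have "(\<Sum>i\<in>UNIV. h $ i * partial_deriv c i x) = grad c x \<bullet> h"
      by (simp add: grad_eq inner_vec_def mult_ac)
    ultimately show ?thesis
      by (simp add: sum_negf inner_add_left inner_diff_left)
  qed
  ultimately have "((\<lambda>\<xi>. hamiltonian T M Q c l \<xi> v p\<^sub>1 p\<^sub>2 u) has_derivative
      (\<lambda>h. - (l *\<^sub>R grad c x + force_hessian Q x *v p\<^sub>2) \<bullet> h)) (at x)"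
    by (simp add: hamiltonian_def force_def grad_eq inner_vec_def[of p\<^sub>2])
  from gradI[OF this] show ?thesis
    by simp
qed

lemma grad_hamiltonian_v:
  assumes "transpose T = T"
  shows "- grad (\<lambda>\<eta>. hamiltonian T M Q c l x \<eta> p\<^sub>1 p\<^sub>2 u) v = - (T *v p\<^sub>1)"
proof -
  have "((\<lambda>\<eta>. - l * c x + (T *v p\<^sub>1) \<bullet> \<eta> + p\<^sub>2 \<bullet> (force Q x + M *v u)) has_derivative
      (\<lambda>h. (T *v p\<^sub>1) \<bullet> h)) (at v)"
    by (auto intro!: derivative_eq_intros)
  then show ?thesis
    by (simp add: hamiltonian_def gradI symmetric_matrix_inner[OF assms, symmetric])
qed

lemma extremal_field_eq:
  assumes "C_infinity Q" "C_infinity c" "transpose T = T"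
  shows "extremal_field T M Q c l (x, v, p\<^sub>1, p\<^sub>2) u =
    (T *v v, force Q x + M *v u, l *\<^sub>R grad c x + force_hessian Q x *v p\<^sub>2, - (T *v p\<^sub>1))"
  by (simp add: extremal_field_def grad_hamiltonian_x grad_hamiltonian_v assms)

lemma has_derivative_C_infinity_fst:
  fixes f :: "real^'n \<Rightarrow> real"
  assumes "C_infinity f"
  shows "((\<lambda>z. f (fst z)) has_derivative (\<lambda>h. \<Sum>i\<in>UNIV. fst h $ i * partial_deriv f i (fst z))) (at z)"
  by (rule has_derivative_compose[OF has_derivative_fst[OF has_derivative_ident]
        C_infinity_has_derivative[OF assms]])

text \<open>Needed to pass from the second to the third derivative of \<open>\<phi>\<close>. The
  field is affine in \<open>p\<^sub>2\<close>, so that direction contributes the matrix itself; the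
  position enters through smooth entries.\<close>

lemma has_derivative_adjoint_field:
  assumes Q: "C_infinity Q" and c: "C_infinity c"
  shows "((\<lambda>(x, v, p\<^sub>1, p\<^sub>2). l *\<^sub>R grad c x + force_hessian Q x *v p\<^sub>2) has_derivative
     (\<lambda>(dx, dv, dp\<^sub>1, dp\<^sub>2). adjoint_jacobian Q c l x p\<^sub>2 *v dx + force_hessian Q x *v dp\<^sub>2))
     (at (x, v, p\<^sub>1, p\<^sub>2))"
proof (rule has_derivative_vec)
  fix i
  let ?z = "(x, v, p\<^sub>1, p\<^sub>2)"
  have p: "((\<lambda>z. snd (snd (snd z)) $ k) has_derivative (\<lambda>h. snd (snd (snd h)) $ k)) (at ?z)" for k
    by (intro bounded_linear.has_derivative[OF bounded_linear_vec_nth] derivative_intros)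
  have D: "((\<lambda>z. l * partial_deriv c i (fst z) +
       (\<Sum>k\<in>UNIV. partial_deriv (partial_deriv Q k) i (fst z) * snd (snd (snd z)) $ k)) has_derivative
     (\<lambda>h. l * (\<Sum>j\<in>UNIV. fst h $ j * partial_deriv (partial_deriv c i) j (fst ?z)) +
       (\<Sum>k\<in>UNIV. partial_deriv (partial_deriv Q k) i (fst ?z) * snd (snd (snd h)) $ k +
         (\<Sum>j\<in>UNIV. fst h $ j * partial_deriv (partial_deriv (partial_deriv Q k) i) j (fst ?z))
           * snd (snd (snd ?z)) $ k))) (at ?z)"
    by (intro has_derivative_add has_derivative_mult_right has_derivative_sum has_derivative_mult p
        has_derivative_C_infinity_fst C_infinity_partial_deriv Q c)
  have R: "l * (\<Sum>j\<in>UNIV. fst h $ j * partial_deriv (partial_deriv c i) j (fst ?z)) +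
       (\<Sum>k\<in>UNIV. partial_deriv (partial_deriv Q k) i (fst ?z) * snd (snd (snd h)) $ k +
         (\<Sum>j\<in>UNIV. fst h $ j * partial_deriv (partial_deriv (partial_deriv Q k) i) j (fst ?z))
           * snd (snd (snd ?z)) $ k) =
      (case h of (dx, dv, dp\<^sub>1, dp\<^sub>2) \<Rightarrow>
        adjoint_jacobian Q c l x p\<^sub>2 *v dx + force_hessian Q x *v dp\<^sub>2) $ i" for h
  proof -
    have "(\<Sum>k\<in>UNIV. (\<Sum>j\<in>UNIV. fst h $ j * partial_deriv (partial_deriv (partial_deriv Q k) i) j x) * p\<^sub>2 $ k)
        = (\<Sum>j\<in>UNIV. (\<Sum>k\<in>UNIV. p\<^sub>2 $ k * partial_deriv (partial_deriv (partial_deriv Q k) i) j x) * fst h $ j)"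
      unfolding sum_distrib_right by (subst sum.swap) (simp add: mult_ac)
    moreover have "l * (\<Sum>j\<in>UNIV. fst h $ j * partial_deriv (partial_deriv c i) j x)
        = (\<Sum>j\<in>UNIV. l * partial_deriv (partial_deriv c i) j x * fst h $ j)"
      by (simp add: sum_distrib_left mult_ac)
    ultimately show ?thesis
      by (simp add: case_prod_beta force_hessian_def adjoint_jacobian_def
        matrix_vector_mult_def distrib_right sum.distrib)
  qed
  have L: "l * partial_deriv c i (fst z) +
       (\<Sum>k\<in>UNIV. partial_deriv (partial_deriv Q k) i (fst z) * snd (snd (snd z)) $ k) =
      (case z of (x, v, p\<^sub>1, p\<^sub>2) \<Rightarrow> l *\<^sub>R grad c x + force_hessian Q x *v p\<^sub>2) $ i" for z
    by (simp add: case_prod_beta grad_eq force_hessian_def matrix_vector_mult_def)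
  show "((\<lambda>z. (case z of (x, v, p\<^sub>1, p\<^sub>2) \<Rightarrow> l *\<^sub>R grad c x + force_hessian Q x *v p\<^sub>2) $ i)
      has_derivative (\<lambda>h. (case h of (dx, dv, dp\<^sub>1, dp\<^sub>2) \<Rightarrow>
        adjoint_jacobian Q c l x p\<^sub>2 *v dx + force_hessian Q x *v dp\<^sub>2) $ i)) (at ?z)"
    using D unfolding L R .
qed

section \<open>Derivatives of the switching function and the order of the problem\<close>

text \<open>The matrix \<open>B\<close> of the definition of the order.\<close>
definition control_matrix ::
  "real^'n^'n \<Rightarrow> real^'n^'n \<Rightarrow> (real^'n \<Rightarrow> real) \<Rightarrow> (real^'n \<Rightarrow> real) \<Rightarrow> real \<Rightarrow>
   'n extremal_point \<Rightarrow> real^'n^'n" where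
  "control_matrix T M Q c l z =
     - (M ** T ** adjoint_jacobian Q c l (fst z) (snd (snd (snd z))) ** T ** M)"

context
  fixes T M :: "real^'n^'n" and Q c :: "real^'n \<Rightarrow> real" and l :: real
  assumes T_sym: "transpose T = T" and Q: "C_infinity Q" and c: "C_infinity c"
begin

lemma switching_deriv_0:
  "switching_deriv T M Q c l 0 = (\<lambda>z u. M *v snd (snd (snd z)))"
  by (auto simp: fun_eq_iff)

lemma switching_deriv_1:
  "switching_deriv T M Q c l (Suc 0) = (\<lambda>z u. - (M *v (T *v fst (snd (snd z)))))"
proof (intro ext)
  fix z :: "'n extremal_point" and u :: "real^'n"
  have "((\<lambda>y. M *v snd (snd (snd y))) has_derivative (\<lambda>h. M *v snd (snd (snd h)))) (at z)"
    by (intro bounded_linear.has_derivative[OF matrix_vector_mul_bounded_linear] derivative_intros)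
  from frechet_derivative_at[OF this]
  show "switching_deriv T M Q c l (Suc 0) z u = - (M *v (T *v fst (snd (snd z))))"
    unfolding switching_deriv.simps(2) switching_deriv_0
    by (cases z) (simp add: extremal_field_eq[OF Q c T_sym] matrix_vector_mult_minus)
qed

lemma switching_deriv_2:
  "switching_deriv T M Q c l (Suc (Suc 0)) =
     (\<lambda>z u. - (M *v (T *v (case z of (x, v, p\<^sub>1, p\<^sub>2) \<Rightarrow> l *\<^sub>R grad c x + force_hessian Q x *v p\<^sub>2))))"
proof (intro ext)
  fix z :: "'n extremal_point" and u :: "real^'n"
  have "((\<lambda>y. - (M *v (T *v fst (snd (snd y))))) has_derivative
      (\<lambda>h. - (M *v (T *v fst (snd (snd h)))))) (at z)"
    by (intro has_derivative_minus bounded_linear.has_derivative[OF matrix_vector_mul_bounded_linear]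
        derivative_intros)
  from frechet_derivative_at[OF this]
  show "switching_deriv T M Q c l (Suc (Suc 0)) z u =
      - (M *v (T *v (case z of (x, v, p\<^sub>1, p\<^sub>2) \<Rightarrow> l *\<^sub>R grad c x + force_hessian Q x *v p\<^sub>2)))"
    unfolding switching_deriv.simps(2)[of _ _ _ _ _ "Suc 0"] switching_deriv_1
    by (cases z) (simp add: extremal_field_eq[OF Q c T_sym])
qed

text \<open>The two terms come from \<open>x' = T v\<close> and
  \<open>p\<^sub>2' = - T p\<^sub>1\<close>. The velocity appears here for the first time, and the
  control acts directly only on \<open>v'\<close>, so the control surfaces one derivative
  later.\<close>

lemma switching_deriv_3:
  "switching_deriv T M Q c l (Suc (Suc (Suc 0))) =
     (\<lambda>z u. - (M *v (T *v (adjoint_jacobian Q c l (fst z) (snd (snd (snd z))) *v (T *v fst (snd z))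
                - force_hessian Q (fst z) *v (T *v fst (snd (snd z)))))))"
proof (intro ext)
  fix z :: "'n extremal_point" and u :: "real^'n"
  obtain x v p\<^sub>1 p\<^sub>2 where z: "z = (x, v, p\<^sub>1, p\<^sub>2)"
    by (cases z)
  have "((\<lambda>y. - (M *v (T *v (case y of (x, v, p\<^sub>1, p\<^sub>2) \<Rightarrow> l *\<^sub>R grad c x + force_hessian Q x *v p\<^sub>2))))
      has_derivative (\<lambda>h. - (M *v (T *v (case h of (dx, dv, dp\<^sub>1, dp\<^sub>2) \<Rightarrow>
        adjoint_jacobian Q c l x p\<^sub>2 *v dx + force_hessian Q x *v dp\<^sub>2))))) (at z)"
    unfolding z
    by (intro has_derivative_minus bounded_linear.has_derivative[OF matrix_vector_mul_bounded_linear]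
        has_derivative_adjoint_field Q c)
  from frechet_derivative_at[OF this, symmetric]
  show "switching_deriv T M Q c l (Suc (Suc (Suc 0))) z u =
      - (M *v (T *v (adjoint_jacobian Q c l (fst z) (snd (snd (snd z))) *v (T *v fst (snd z))
                - force_hessian Q (fst z) *v (T *v fst (snd (snd z))))))"
    unfolding switching_deriv.simps(2)[of _ _ _ _ _ "Suc (Suc 0)"] switching_deriv_2
    by (simp add: z extremal_field_eq[OF Q c T_sym] matrix_vector_mult_minus)
qed

lemma switching_deriv_control_indep:
  "k < 4 \<Longrightarrow> switching_deriv T M Q c l k z u = switching_deriv T M Q c l k z w"
  by (auto simp: less_Suc_eq numeral_eq_Suc switching_deriv_0 switching_deriv_1 switching_deriv_2
      switching_deriv_3 simp del: switching_deriv.simps)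

lemma switching_deriv_differentiable:
  assumes "k < 4"
  shows "(\<lambda>z. switching_deriv T M Q c l k z u) differentiable (at z)"
proof -
  have lin: "(\<lambda>z. A *v f z) differentiable (at z)" if "f differentiable (at z)"
    for A :: "real^'n^'n" and f :: "'n extremal_point \<Rightarrow> real^'n"
    using bounded_linear.has_derivative[OF matrix_vector_mul_bounded_linear
        that[unfolded frechet_derivative_works]] by (rule differentiableI)
  have smooth: "(\<lambda>z. f (fst z)) differentiable (at z)" if "C_infinity f" for f :: "real^'n \<Rightarrow> real"
    using has_derivative_C_infinity_fst[OF that] by (rule differentiableI)
  have proj: "fst differentiable (at z)" "(\<lambda>z. fst (snd z)) differentiable (at z)"
    "(\<lambda>z. fst (snd (snd z))) differentiable (at z)" "(\<lambda>z. snd (snd (snd z))) differentiable (at z)"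
    for z :: "'n extremal_point"
    by (rule differentiableI, (rule derivative_intros)+)+
  have adj: "(\<lambda>z. case z of (x, v, p\<^sub>1, p\<^sub>2) \<Rightarrow> l *\<^sub>R grad c x + force_hessian Q x *v p\<^sub>2) differentiable (at z)"
    using has_derivative_adjoint_field[OF Q c] by (cases z) (blast intro: differentiableI)
  have "(\<lambda>z. snd (snd (snd z)) $ k) differentiable (at z)" for k
    using bounded_linear.has_derivative[OF bounded_linear_vec_nth
        proj(4)[unfolded frechet_derivative_works]] by (rule differentiableI)
  then have mat: "(\<lambda>z. force_hessian Q (fst z) $ i $ j) differentiable (at z)"
    "(\<lambda>z. adjoint_jacobian Q c l (fst z) (snd (snd (snd z))) $ i $ j) differentiable (at z)" for i j
    unfolding force_hessian_def adjoint_jacobian_def vec_lambda_beta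
    by (intro smooth differentiable_add differentiable_mult differentiable_const differentiable_sum
        C_infinity_partial_deriv Q c finite_class.finite_UNIV ballI | assumption)+
  consider "k = 0" | "k = Suc 0" | "k = Suc (Suc 0)" | "k = Suc (Suc (Suc 0))"
    using assms by linarith
  then show ?thesis
    by cases (simp_all add: switching_deriv_0 switching_deriv_1 switching_deriv_2 switching_deriv_3
        lin proj adj mat differentiable_minus differentiable_diff differentiable_matrix_vector_mult
        del: switching_deriv.simps)
qed

text \<open>Only the velocity moves along this line, and the third derivative is affine in it, so
  the entries of \<open>adjoint_jacobian\<close> and \<open>force_hessian\<close> need not be
  differentiated.\<close>

lemma switching_deriv_4_velocity:
  "frechet_derivative (\<lambda>z. switching_deriv T M Q c l 3 z u) (at z) (0, w, 0, 0) =
    - (M *v (T *v (adjoint_jacobian Q c l (fst z) (snd (snd (snd z))) *v (T *v w))))"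
proof (rule frechet_derivative_along_line)
  fix s :: real
  show "switching_deriv T M Q c l 3 (z + s *\<^sub>R (0, w, 0, 0)) u = switching_deriv T M Q c l 3 z u +
      s *\<^sub>R - (M *v (T *v (adjoint_jacobian Q c l (fst z) (snd (snd (snd z))) *v (T *v w))))"
    unfolding numeral_3_eq_3 switching_deriv_3
    by (cases z) (simp add: matrix_vector_right_distrib matrix_vector_mult_diff_distrib
        matrix_vector_mult_scaleR algebra_simps)
qed (simp add: switching_deriv_differentiable)

lemma switching_deriv_4:
  "switching_deriv T M Q c l 4 z u =
    switching_deriv T M Q c l 4 z 0 + control_matrix T M Q c l z *v u"
proof -
  let ?f = "\<lambda>u z. switching_deriv T M Q c l 3 z u"
  \<comment> \<open>Fixing the control at 0 makes the differentiated function the same for all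
    controls; the control then remains only in the direction, where linearity applies.\<close>
  have indep: "?f w = ?f 0" for w
    using switching_deriv_control_indep by (intro ext) simp
  have four: "switching_deriv T M Q c l 4 z w =
      frechet_derivative (?f 0) (at z) (extremal_field T M Q c l z w)" for w
  proof -
    have "switching_deriv T M Q c l 4 z w =
        frechet_derivative (?f w) (at z) (extremal_field T M Q c l z w)"
      by (simp add: numeral_eq_Suc)
    then show ?thesis
      unfolding indep[of w] .
  qed
  have "extremal_field T M Q c l z u = extremal_field T M Q c l z 0 + (0, M *v u, 0, 0)"
    by (cases z) (simp add: extremal_field_eq[OF Q c T_sym])
  moreover have "linear (frechet_derivative (?f 0) (at z))"
    by (simp add: linear_frechet_derivative switching_deriv_differentiable)
  ultimately have "switching_deriv T M Q c l 4 z u = switching_deriv T M Q c l 4 z 0 +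
      frechet_derivative (?f 0) (at z) (0, M *v u, 0, 0)"
    unfolding four by (simp only: linear_add)
  then show ?thesis
    by (simp add: switching_deriv_4_velocity control_matrix_def matrix_vector_mult_uminus
        matrix_vector_mul_assoc matrix_mul_assoc)
qed

lemma jacobian_switching_deriv_4:
  "jacobian (switching_deriv T M Q c l 4 z) (at u) = control_matrix T M Q c l z"
proof -
  have "((\<lambda>u. switching_deriv T M Q c l 4 z 0 + control_matrix T M Q c l z *v u) has_derivative
      (\<lambda>h. 0 + control_matrix T M Q c l z *v h)) (at u)"
    by (intro has_derivative_add has_derivative_const has_derivative_ident
        bounded_linear.has_derivative[OF matrix_vector_mul_bounded_linear])
  moreover have "(\<lambda>u. switching_deriv T M Q c l 4 z 0 + control_matrix T M Q c l z *v u) =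
      switching_deriv T M Q c l 4 z"
    using switching_deriv_4 by (intro ext) (rule sym)
  ultimately have "(switching_deriv T M Q c l 4 z has_derivative (\<lambda>h. control_matrix T M Q c l z *v h)) (at u)"
    by (simp only: add_0)
  from frechet_derivative_at[OF this, symmetric] show ?thesis
    by (simp only: jacobian_def matrix_of_matrix_vector_mul)
qed

lemma jacobian_switching_deriv_less_4:
  assumes "k < 4"
  shows "jacobian (switching_deriv T M Q c l k z) (at u) = 0"
proof -
  have eq: "(\<lambda>u. switching_deriv T M Q c l k z 0) = switching_deriv T M Q c l k z"
    by (intro ext) (rule switching_deriv_control_indep[OF assms])
  have "((\<lambda>u. switching_deriv T M Q c l k z 0) has_derivative (\<lambda>h. 0)) (at u)"
    by (rule has_derivative_const)
  from frechet_derivative_at[OF this[unfolded eq], symmetric] show ?thesis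
    by (simp only: jacobian_def matrix_def vec_eq_iff vec_lambda_beta zero_index simp_thms)
qed

text \<open>The third-order partials of \<open>Q\<close> are weighted by the components of
  \<open>p\<^sub>2\<close> and drop out when it is 0, leaving only the curvature of the
  cost.\<close>

lemma adjoint_jacobian_origin: "adjoint_jacobian Q c l x 0 = l *\<^sub>R hessian c x"
  by (simp add: adjoint_jacobian_def hessian_eq[OF c] vec_eq_iff)

lemma control_matrix_invertible_iff:
  assumes "invertible T" "invertible M"
  shows "invertible (control_matrix T M Q c l z) \<longleftrightarrow>
    invertible (adjoint_jacobian Q c l (fst z) (snd (snd (snd z))))"
proof -
  have "invertible (- A) \<longleftrightarrow> invertible A" for A :: "real^'n^'n"
    by (simp add: invertible_left_inverse matrix_left_invertible_ker matrix_vector_mult_uminus)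
  then show ?thesis
    using assms by (simp add: control_matrix_def invertible_det_nz det_mul)
qed

text \<open>Invertibility is an open condition: the determinant is a polynomial in the entries, and
  the entries converge by continuity of the partial derivatives.\<close>

lemma eventually_invertible_adjoint_jacobian:
  assumes x: "(x \<longlongrightarrow> x\<^sub>0) F" and q: "(q \<longlongrightarrow> q\<^sub>0) F"
    and inv: "invertible (adjoint_jacobian Q c l x\<^sub>0 q\<^sub>0)"
  shows "\<forall>\<^sub>F t in F. invertible (adjoint_jacobian Q c l (x t) (q t))"
proof -
  have smooth: "((\<lambda>t. f (x t)) \<longlongrightarrow> f x\<^sub>0) F" if "C_infinity f" for f :: "real^'n \<Rightarrow> real"
    using C_infinity_continuous_on[OF that, of UNIV] x
    by (auto simp: continuous_on_eq_continuous_at intro: isCont_tendsto_compose)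
  have "((\<lambda>t. det (adjoint_jacobian Q c l (x t) (q t))) \<longlongrightarrow> det (adjoint_jacobian Q c l x\<^sub>0 q\<^sub>0)) F"
    unfolding det_def adjoint_jacobian_def vec_lambda_beta
    by (intro tendsto_intros smooth q C_infinity_partial_deriv Q c)
  moreover have "det (adjoint_jacobian Q c l x\<^sub>0 q\<^sub>0) \<noteq> 0"
    using inv by (simp add: invertible_det_nz)
  ultimately have "\<forall>\<^sub>F t in F. det (adjoint_jacobian Q c l (x t) (q t)) \<noteq> 0"
    by (rule tendsto_imp_eventually_ne)
  then show ?thesis
    by (simp add: invertible_det_nz)
qed

lemma junction_order_2:
  assumes x: "isCont x t\<^sub>c" "x t\<^sub>c = 0" and p: "isCont p\<^sub>2 t\<^sub>c" "p\<^sub>2 t\<^sub>c = 0" and "l = 1"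
    and "positive_definite (hessian c 0)" and inv: "invertible T" "invertible M"
  shows "junction_order T M Q c l (\<lambda>t. (x t, v t, p\<^sub>1 t, p\<^sub>2 t)) t\<^sub>c 2"
proof -
  note iff = control_matrix_invertible_iff[OF inv]
  have adj: "invertible (adjoint_jacobian Q c l 0 0)"
    unfolding adjoint_jacobian_origin using assms by (simp add: positive_definite_imp_invertible)
  then have "invertible (control_matrix T M Q c l 0)"
    by (simp add: iff)
  \<comment> \<open>An invertible matrix does not kill the all-ones vector, hence is not the zero
    matrix. The extremal point 0 thus witnesses that the fourth derivative depends on the
    control.\<close>
  from invertible_matrix_vector_eq_0_iff[OF this, of 1] have "control_matrix T M Q c l 0 \<noteq> 0"
    by auto
  then have "problem_order T M Q c l 2"
    unfolding problem_order_def
    by (intro conjI exI[of _ 0])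
      (simp_all add: jacobian_switching_deriv_4 jacobian_switching_deriv_less_4
        del: switching_deriv.simps)
  moreover have "\<forall>\<^sub>F t in at t\<^sub>c. invertible (control_matrix T M Q c l (x t, v t, p\<^sub>1 t, p\<^sub>2 t))"
    using eventually_invertible_adjoint_jacobian[of x "x t\<^sub>c" "at t\<^sub>c" p\<^sub>2 "p\<^sub>2 t\<^sub>c"] x p adj
    by (simp add: iff isCont_def)
  \<comment> \<open>The limit argument covers a punctured neighborhood; the junction time itself is
    added to obtain a full one.\<close>
  moreover have "invertible (control_matrix T M Q c l (x t\<^sub>c, v t\<^sub>c, p\<^sub>1 t\<^sub>c, p\<^sub>2 t\<^sub>c))"
    using x p adj by (simp add: iff)
  ultimately have "\<forall>\<^sub>F t in nhds t\<^sub>c. invertible (control_matrix T M Q c l (x t, v t, p\<^sub>1 t, p\<^sub>2 t))"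
    by (simp add: eventually_nhds_conv_at)
  moreover have "\<forall>y u. switching_deriv T M Q c l (2 * 2) y u =
      switching_deriv T M Q c l 4 y 0 + control_matrix T M Q c l y *v u"
  proof -
    have four: "2 * 2 = (4::nat)"
      by simp
    show ?thesis
      unfolding four by (intro allI) (rule switching_deriv_4)
  qed
  ultimately show ?thesis
    unfolding junction_order_def using \<open>problem_order T M Q c l 2\<close>
    by (intro conjI exI[of _ "\<lambda>z. switching_deriv T M Q c l 4 z 0"] exI[of _ "control_matrix T M Q c l"])
qed

end

section \<open>Fourth-order behavior on leaving the origin under a constant control\<close>

text \<open>Taylor behavior at a one-sided endpoint: the first nonzero derivative, of order
  \<open>Suc m\<close>, fixes the sign, and each level inherits it from the next by the mean value
  theorem.\<close>

lemma negative_near_start: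
  fixes f :: "nat \<Rightarrow> real \<Rightarrow> real"
  assumes "0 < b"
    and deriv: "\<And>k t. k < Suc m \<Longrightarrow> t \<in> {0..b} \<Longrightarrow> (f k has_real_derivative f (Suc k) t) (at t within {0..b})"
    and zero: "\<And>k. k < Suc m \<Longrightarrow> f k 0 = 0" and neg: "f (Suc m) 0 < 0"
  shows "\<exists>d. 0 < d \<and> d \<le> b \<and> (\<forall>t\<in>{0<..<d}. f 0 t < 0)"
  using deriv zero neg
proof (induction m arbitrary: f)
  case 0
  then have "(f 0 has_real_derivative f (Suc 0) 0) (at 0 within {0..b})"
    using \<open>0 < b\<close> by simp
  from has_real_derivative_neg_dec_right[OF this] 0 obtain d where
    d: "d > 0" "\<And>h. 0 < h \<Longrightarrow> h \<in> {0..b} \<Longrightarrow> h < d \<Longrightarrow> f 0 h < 0"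
    by auto
  then show ?case
    using \<open>0 < b\<close> by (intro exI[of _ "min d b"]) auto
next
  case (Suc m)
  \<comment> \<open>The sequence shifted by one starts at the first derivative and has one vanishing
    order fewer.\<close>
  have "\<exists>d. 0 < d \<and> d \<le> b \<and> (\<forall>t\<in>{0<..<d}. f (Suc 0) t < 0)"
    using Suc.prems by (intro Suc.IH[of "\<lambda>k. f (Suc k)"]) auto
  then obtain d where d: "0 < d" "d \<le> b" "\<And>t. t \<in> {0<..<d} \<Longrightarrow> f (Suc 0) t < 0"
    by auto
  have "f 0 t < 0" if t: "t \<in> {0<..<d}" for t
  proof -
    have D: "(f 0 has_real_derivative f (Suc 0) s) (at s within {0..t})" if "s \<in> {0..t}" for s
      using Suc.prems(1)[of 0 s] that t d by (auto elim: DERIV_subset)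
    have "\<exists>s\<in>{0<..<t}. f 0 t - f 0 0 = (t - 0) * f (Suc 0) s"
    proof -
      have "continuous_on {0..t} (f 0)"
        using D by (meson DERIV_continuous_on)
      moreover have "(f 0 has_derivative (\<lambda>h. f (Suc 0) s * h)) (at s)" if "0 < s" "s < t" for s
      proof -
        have "(f 0 has_real_derivative f (Suc 0) s) (at s)"
          using D[of s] that by (simp add: at_within_Icc_at)
        then show ?thesis
          by (simp add: has_field_derivative_def)
      qed
      ultimately obtain s where "0 < s" "s < t" "f 0 t - f 0 0 = f (Suc 0) s * (t - 0)"
        using mvt[of 0 t "f 0" "\<lambda>s h. f (Suc 0) s * h"] t by auto
      then show ?thesis
        by (intro bexI[of _ s]) auto
    qed
    then obtain s where s: "s \<in> {0<..<t}" "f 0 t - f 0 0 = (t - 0) * f (Suc 0) s"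
      by auto
    with d(3)[of s] t have "t * f (Suc 0) s < 0"
      by (auto simp: mult_pos_neg)
    with s Suc.prems(2)[of 0] show ?thesis
      by simp
  qed
  with d show ?case
    by blast
qed

text \<open>
  With a constant control \<open>w\<close>, the function \<open>w \<bullet> \<phi>\<close> leaves the origin with its first three derivatives
  zero and its fourth derivative \<open>w \<bullet> B w < 0\<close>. The sign \<open>\<sigma>\<close> covers both time directions,
  as \<open>\<sigma> ^ 4 = 1\<close>.
\<close>
lemma constant_control_from_origin:
  fixes T M :: "real^'n^'n" and Q c :: "real^'n \<Rightarrow> real" and z :: "real \<Rightarrow> 'n extremal_point"
  assumes T: "transpose T = T" "invertible T" and M: "transpose M = M" "invertible M"
    and Q: "C_infinity Q" and c: "C_infinity c" and "force Q 0 = 0" and "grad c 0 = 0"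
    and "positive_definite (hessian c 0)"
    and "0 < b" and \<sigma>: "\<sigma> \<in> {-1, 1}" and "w \<noteq> 0" and "z t\<^sub>c = 0"
    and ode: "\<And>s. s \<in> {0..b} \<Longrightarrow> ((\<lambda>s. z (t\<^sub>c + \<sigma> * s)) has_vector_derivative
        \<sigma> *\<^sub>R extremal_field T M Q c 1 (z (t\<^sub>c + \<sigma> * s)) w) (at s within {0..b})"
  obtains s where "s \<in> {0<..<b}" "w \<bullet> (M *v snd (snd (snd (z (t\<^sub>c + \<sigma> * s))))) < 0"
proof -
  \<comment> \<open>The power of \<open>\<sigma>\<close> is the chain-rule factor of the time
    change, so that \<open>f (Suc k)\<close> is exactly the derivative of \<open>f k\<close> for
    \<open>k < 4\<close>.\<close>
  define f where "f k s = \<sigma> ^ k * (w \<bullet> switching_deriv T M Q c 1 k (z (t\<^sub>c + \<sigma> * s)) w)" for k s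
  note sd = switching_deriv_0[OF T(1) Q c] switching_deriv_1[OF T(1) Q c]
    switching_deriv_2[OF T(1) Q c] switching_deriv_3[OF T(1) Q c]
  have "(f k has_real_derivative f (Suc k) s) (at s within {0..b})" if "k < Suc 3" "s \<in> {0..b}" for k s
  proof -
    let ?z = "z (t\<^sub>c + \<sigma> * s)"
    have D: "((\<lambda>y. switching_deriv T M Q c 1 k y w) has_derivative
        frechet_derivative (\<lambda>y. switching_deriv T M Q c 1 k y w) (at ?z)) (at ?z)"
      using switching_deriv_differentiable[OF T(1) Q c] that(1)
      by (simp add: frechet_derivative_works[symmetric])
    from has_derivative_compose[OF ode[OF that(2), unfolded has_vector_derivative_def] D]
    have "((\<lambda>s. switching_deriv T M Q c 1 k (z (t\<^sub>c + \<sigma> * s)) w) has_derivative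
        (\<lambda>h. h *\<^sub>R (\<sigma> *\<^sub>R switching_deriv T M Q c 1 (Suc k) ?z w))) (at s within {0..b})"
      by (simp add: linear_cmul[OF has_derivative_linear[OF D]])
    then have "((\<lambda>s. \<sigma> ^ k * (w \<bullet> switching_deriv T M Q c 1 k (z (t\<^sub>c + \<sigma> * s)) w)) has_derivative
        (\<lambda>h. \<sigma> ^ k * (w \<bullet> (h *\<^sub>R (\<sigma> *\<^sub>R switching_deriv T M Q c 1 (Suc k) ?z w))))) (at s within {0..b})"
      by (intro has_derivative_mult_right has_derivative_inner_right)
    then show ?thesis
      unfolding f_def
      by (rule has_derivative_imp_has_field_derivative) (simp add: mult_ac del: switching_deriv.simps)
  qed
  \<comment> \<open>At the rest point with zero adjoints, force and cost gradient vanish and only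
    the push of the control on the velocity remains.\<close>
  moreover have field: "extremal_field T M Q c 1 0 w = (0, M *v w, 0, 0)"
    using extremal_field_eq[OF Q c T(1), of M 1 0 0 0 0 w] assms by (simp add: zero_prod_def)
  have "f k 0 = 0" if "k < Suc 3" for k
  proof -
    consider "k = 0" | "k = Suc 0" | "k = Suc (Suc 0)" | "k = Suc (Suc (Suc 0))"
      using \<open>k < Suc 3\<close> by linarith
    then show ?thesis
      by cases (simp_all add: f_def sd assms zero_prod_def case_prod_beta del: switching_deriv.simps)
  qed
  moreover have "f (Suc 3) 0 < 0"
  proof -
    \<comment> \<open>Moving the symmetric matrices \<open>M\<close> and \<open>T\<close> onto
      \<open>w\<close> turns the fourth derivative of \<open>w \<bullet> \<phi>\<close> into minus
      the Hessian form at this vector.\<close>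
    let ?y = "T *v (M *v w)"
    have "switching_deriv T M Q c 1 (Suc 3) 0 w = - (M *v (T *v (hessian c 0 *v ?y)))"
      unfolding switching_deriv.simps(2)[of _ _ _ _ _ 3] field
        switching_deriv_4_velocity[OF T(1) Q c]
      by (simp add: adjoint_jacobian_origin[OF T(1) Q c])
    then have "f (Suc 3) 0 = - (?y \<bullet> (hessian c 0 *v ?y))"
      using \<sigma> assms by (auto simp: f_def symmetric_matrix_inner del: switching_deriv.simps)
    moreover have "?y \<noteq> 0"
      using assms by (simp add: invertible_matrix_vector_eq_0_iff)
    ultimately show ?thesis
      using assms by (simp add: positive_definite_def)
  qed
  ultimately have "\<exists>d. 0 < d \<and> d \<le> b \<and> (\<forall>s\<in>{0<..<d}. f 0 s < 0)"
    using \<open>0 < b\<close> by (intro negative_near_start[of b 3]) 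
  then obtain d where "0 < d" "d \<le> b" "\<forall>s\<in>{0<..<d}. f 0 s < 0"
    by blast
  then have "d / 2 \<in> {0<..<b}" "f 0 (d / 2) < 0"
    by auto
  then show ?thesis
    using that[of "d / 2"] by (simp add: f_def sd case_prod_beta)
qed

section \<open>From almost-everywhere statements to pointwise ones\<close>

text \<open>A nonempty open set is not null, so it cannot lie inside the exceptional set.\<close>

lemma AE_lebesgue_open_ex:
  fixes U :: "real set"
  assumes "AE t\<in>S in lebesgue. P t" "open U" "U \<noteq> {}" "U \<subseteq> S"
  obtains t where "t \<in> U" "P t"
proof (rule ccontr)
  assume "\<not> thesis"
  with that have "U \<subseteq> {t. \<not> (t \<in> S \<longrightarrow> P t)}"
    using \<open>U \<subseteq> S\<close> by auto
  then have "negligible U"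
    using assms(1) unfolding eventually_ae_filter_negligible by (meson negligible_subset order_trans)
  with assms(2,3) show False
    by (simp add: open_not_negligible)
qed

lemma AE_subset: "AE t\<in>S in M. P t \<Longrightarrow> R \<subseteq> S \<Longrightarrow> AE t\<in>R in M. P t"
  by (erule eventually_mono) auto

lemma continuous_AE_zero_imp_zero:
  fixes f :: "real \<Rightarrow> 'a::real_normed_vector"
  assumes "AE t\<in>U in lebesgue. f t = 0" and U: "open U" and f: "continuous_on U f" and "t \<in> U"
  shows "f t = 0"
proof (rule ccontr)
  assume "f t \<noteq> 0"
  have "open (U \<inter> f -` (- {0}))"
    by (rule continuous_open_preimage[OF f U]) auto
  moreover have "U \<inter> f -` (- {0}) \<noteq> {}"
    using \<open>f t \<noteq> 0\<close> \<open>t \<in> U\<close> by auto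
  ultimately show False
    using AE_lebesgue_open_ex[OF assms(1)] by (metis ComplD IntE inf_le1 insertI1 vimage_eq)
qed

text \<open>Kept apart from the version with continuous \<open>g\<close> because the velocity
  equation contains the control, which is only measurable.\<close>

lemma zero_imp_AE_derivative_zero:
  fixes f :: "real \<Rightarrow> 'a::real_normed_vector"
  assumes deriv: "AE t\<in>U in lebesgue. (f has_vector_derivative g t) (at t)"
    and U: "open U" and f: "\<And>t. t \<in> U \<Longrightarrow> f t = 0"
  shows "AE t\<in>U in lebesgue. g t = 0"
  using deriv
proof eventually_elim
  case (elim t)
  show ?case
  proof
    assume "t \<in> U"
    have "((\<lambda>_. 0) has_vector_derivative g t) (at t)"
      using elim \<open>t \<in> U\<close> U f by (metis (mono_tags, lifting) has_vector_derivative_transform_within_open)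
    then show "g t = 0"
      by (metis has_vector_derivative_const vector_derivative_unique_at)
  qed
qed

lemma zero_imp_derivative_zero:
  fixes f :: "real \<Rightarrow> 'a::real_normed_vector"
  assumes "AE t\<in>U in lebesgue. (f has_vector_derivative g t) (at t)"
    and "open U" and "\<And>t. t \<in> U \<Longrightarrow> f t = 0" and "continuous_on U g" and "t \<in> U"
  shows "g t = 0"
  using continuous_AE_zero_imp_zero[OF zero_imp_AE_derivative_zero[OF assms(1-3)]] assms by blast

lemma continuous_on_C_infinity_compose:
  fixes f :: "real^'n \<Rightarrow> real"
  assumes "C_infinity f" "continuous_on S x"
  shows "continuous_on S (\<lambda>t. f (x t))"
  by (rule continuous_on_compose2[OF C_infinity_continuous_on[OF assms(1), of UNIV] assms(2)]) simp

lemma continuous_on_matrix_vector_mult: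
  fixes A :: "real^'n^'m"
  shows "continuous_on S f \<Longrightarrow> continuous_on S (\<lambda>t. A *v f t)"
  by (rule bounded_linear.continuous_on[OF matrix_vector_mul_bounded_linear])

section \<open>Bang-bang controls and their continuity\<close>

text \<open>Compare \<open>u\<close> with the control that differs from it only in component
  \<open>i\<close>, where it takes the sign of \<open>\<phi> $ i\<close>. The inequality form also
  covers zeros of that component.\<close>

lemma maximal_on_control_box:
  fixes \<phi> u :: "real^'n"
  assumes u: "u \<in> control_box" and max: "\<And>w. w \<in> control_box \<Longrightarrow> \<phi> \<bullet> w \<le> \<phi> \<bullet> u"
  shows "\<bar>\<phi> $ i\<bar> \<le> \<phi> $ i * u $ i"
proof -
  let ?w = "u + axis i (sgn (\<phi> $ i) - u $ i)"
  have "?w $ j = (if j = i then sgn (\<phi> $ i) else u $ j)" for j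
    by (simp add: axis_def)
  then have "?w \<in> control_box"
    using u by (simp add: control_box_def abs_sgn_eq)
  from max[OF this] have "\<phi> $ i * (sgn (\<phi> $ i) - u $ i) \<le> 0"
    by (simp add: inner_add_right inner_axis)
  then show ?thesis
    by (simp add: abs_sgn right_diff_distrib)
qed

lemma real_analytic_on_imp_isCont:
  fixes f :: "real \<Rightarrow> real^'n"
  assumes "real_analytic_on f S" "s \<in> S"
  shows "isCont f s"
proof -
  obtain r a where "r > 0" and sums: "\<And>t. \<bar>t - s\<bar> < r \<Longrightarrow> (\<lambda>k. (t - s) ^ k *\<^sub>R a k) sums f t"
    using assms unfolding real_analytic_on_def by metis
  have "isCont (\<lambda>t. f t $ i) s" for i
  proof -
    have i: "(\<lambda>k. a k $ i * (t - s) ^ k) sums (f t $ i)" if "\<bar>t - s\<bar> < r" for t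
      using bounded_linear.sums[OF bounded_linear_vec_nth sums[OF that], of i] by (simp add: mult.commute)
    \<comment> \<open>Convergence at distance \<open>r / 2\<close> puts the center strictly inside
      the disc of convergence, where a power series is continuous.\<close>
    have "summable (\<lambda>k. a k $ i * (r / 2) ^ k)"
      using i[of "s + r / 2"] \<open>r > 0\<close> by (simp add: sums_iff)
    then have "isCont (\<lambda>y. \<Sum>k. a k $ i * y ^ k) (s - s)"
      using \<open>r > 0\<close> by (intro isCont_powser) auto
    moreover have "isCont (\<lambda>t. t - s) s"
      by (intro continuous_intros)
    ultimately have "isCont (\<lambda>t. \<Sum>k. a k $ i * (t - s) ^ k) s"
      by (rule isCont_o2[rotated])
    moreover have "\<forall>\<^sub>F t in nhds s. (\<Sum>k. a k $ i * (t - s) ^ k) = f t $ i"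
      using i \<open>r > 0\<close> unfolding eventually_nhds_metric
      by (intro exI[of _ r]) (auto simp: dist_real_def sums_iff)
    ultimately show ?thesis
      by (rule isCont_cong[THEN iffD1, rotated])
  qed
  then show ?thesis
    by (auto simp: isCont_def intro: vec_tendstoI)
qed

text \<open>
  A component of the control equal to the sign of \<open>\<phi>\<^sub>i\<close> almost everywhere cannot be essentially continuous
  where \<open>\<phi>\<^sub>i\<close> takes both signs nearby.
\<close>
lemma continuous_bang_control_constant:
  fixes \<phi> u :: "real \<Rightarrow> real^'n"
  assumes \<phi>: "continuous_on {a<..<b} \<phi>"
    and nonzero: "nonsingular_on \<phi> {a<..<b}"
    and max: "AE t\<in>{a<..<b} in lebesgue. \<forall>i. \<bar>\<phi> t $ i\<bar> \<le> \<phi> t $ i * u t $ i \<and> \<bar>u t $ i\<bar> \<le> 1"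
    and cont: "\<And>s. s \<in> {a<..<b} \<Longrightarrow> \<not> control_discontinuous_at u s"
  obtains w where "\<And>i. \<bar>w $ i\<bar> = 1" "AE t\<in>{a<..<b} in lebesgue. u t = w"
    "\<And>t i. t \<in> {a<..<b} \<Longrightarrow> 0 \<le> \<phi> t $ i * w $ i"
proof -
  have bang: "u t $ i = sgn (\<phi> t $ i)"
    if "\<bar>\<phi> t $ i\<bar> \<le> \<phi> t $ i * u t $ i" "\<bar>u t $ i\<bar> \<le> 1" "\<phi> t $ i \<noteq> 0" for t i
  proof (cases "\<phi> t $ i > 0")
    case True
    with that have "1 \<le> u t $ i"
      by (simp add: mult_le_cancel_left1 abs_of_pos)
    with that True show ?thesis by simp
  next
    case False
    with that have "\<phi> t $ i * (u t $ i + 1) \<ge> 0"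
      by (simp add: distrib_left)
    with False that have "u t $ i + 1 \<le> 0"
      by (simp add: zero_le_mult_iff)
    with that False show ?thesis by simp
  qed
  have cont_i: "continuous_on {a<..<b} (\<lambda>t. \<phi> t $ i)" for i
    using \<phi> by (rule continuous_on_component)
  have sign_open: "open {t\<in>{a<..<b}. 0 < \<sigma> * \<phi> t $ i}" for \<sigma> i
  proof -
    have "open ({a<..<b} \<inter> (\<lambda>t. \<sigma> * \<phi> t $ i) -` {0<..})"
      by (intro continuous_open_preimage continuous_on_mult continuous_on_const cont_i) auto
    then show ?thesis
      by (simp add: Int_def vimage_def)
  qed
  \<comment> \<open>Bang-bang values 1 and -1 are 2 apart, so a version of the control staying
    within 1 of its value at \<open>s\<close> cannot take both; hence \<open>\<phi> $ i\<close>
    keeps a weak sign near \<open>s\<close>.\<close>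
  have local: "\<exists>V. open V \<and> s \<in> V \<and> V \<subseteq> {a<..<b} \<and>
      ((\<forall>t\<in>V. 0 \<le> \<phi> t $ i) \<or> (\<forall>t\<in>V. \<phi> t $ i \<le> 0))" if s: "s \<in> {a<..<b}" for s i
  proof -
    obtain \<epsilon> w where "\<epsilon> > 0" and wu: "AE t\<in>{s - \<epsilon><..<s + \<epsilon>} in lebesgue. w t = u t" and "isCont w s"
      using cont[OF s] unfolding control_discontinuous_at_def by blast
    from \<open>isCont w s\<close> have "isCont (\<lambda>t. w t $ i) s"
      by (rule continuous_component)
    then obtain \<delta> where "\<delta> > 0" and \<delta>: "\<And>t. \<bar>t - s\<bar> < \<delta> \<Longrightarrow> \<bar>w t $ i - w s $ i\<bar> < 1"
      unfolding continuous_at_eps_delta by (metis dist_real_def real_norm_def zero_less_one)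
    define V where "V = {a<..<b} \<inter> {s - \<epsilon><..<s + \<epsilon>} \<inter> {s - \<delta><..<s + \<delta>}"
    have V: "open V" "s \<in> V" "V \<subseteq> {a<..<b}"
      using s \<open>\<epsilon> > 0\<close> \<open>\<delta> > 0\<close> by (auto simp: V_def)
    \<comment> \<open>The times in \<open>V\<close> where \<open>\<phi> $ i\<close> has the sign of
      \<open>\<sigma>\<close> form a nonempty open set, which contains a time where \<open>w\<close>
      agrees with \<open>u\<close> and maximality holds.\<close>
    have attained: "\<exists>t\<in>V. w t $ i = sgn \<sigma>" if "r \<in> V" "0 < \<sigma> * \<phi> r $ i" for r and \<sigma> :: real
    proof -
      have "AE t\<in>V in lebesgue. w t = u t \<and> \<bar>\<phi> t $ i\<bar> \<le> \<phi> t $ i * u t $ i \<and> \<bar>u t $ i\<bar> \<le> 1"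
        using wu max by eventually_elim (auto simp: V_def)
      moreover have "open (V \<inter> {t\<in>{a<..<b}. 0 < \<sigma> * \<phi> t $ i})"
        using V sign_open by blast
      moreover have "V \<inter> {t\<in>{a<..<b}. 0 < \<sigma> * \<phi> t $ i} \<noteq> {}"
        using that subsetD[OF V(3) that(1)] by blast
      ultimately obtain t where t: "t \<in> V" "0 < \<sigma> * \<phi> t $ i" "w t = u t"
          "\<bar>\<phi> t $ i\<bar> \<le> \<phi> t $ i * u t $ i" "\<bar>u t $ i\<bar> \<le> 1"
        by (rule AE_lebesgue_open_ex) auto
      then have "u t $ i = sgn (\<phi> t $ i)"
        by (intro bang) auto
      also have "\<dots> = sgn \<sigma>"
        using t(2) by (auto simp: zero_less_mult_iff)
      finally show ?thesis
        using t(1,3) by (intro bexI[of _ t]) simp_all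
    qed
    have "(\<forall>t\<in>V. 0 \<le> \<phi> t $ i) \<or> (\<forall>t\<in>V. \<phi> t $ i \<le> 0)"
    proof (rule ccontr)
      assume "\<not> ?thesis"
      then obtain r r' where "r \<in> V" "\<phi> r $ i < 0" "r' \<in> V" "0 < \<phi> r' $ i"
        by (auto simp: not_le)
      then obtain t t' where "t \<in> V" "w t $ i = -1" "t' \<in> V" "w t' $ i = 1"
        using attained[of r "-1"] attained[of r' 1] by auto
      moreover from this have "\<bar>t - s\<bar> < \<delta>" "\<bar>t' - s\<bar> < \<delta>"
        by (auto simp: V_def abs_less_iff)
      note \<delta>[OF this(1)] \<delta>[OF this(2)]
      ultimately show False
        by linarith
    qed
    with V show ?thesis
      by blast
  qed
  have "\<exists>\<sigma>. \<bar>\<sigma>\<bar> = 1 \<and> (\<forall>t\<in>{a<..<b}. 0 \<le> \<phi> t $ i * \<sigma>)" for i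
  proof -
    \<comment> \<open>The local argument covers the interval by these two open sets. On an overlap
      \<open>\<phi> $ i\<close> would vanish, contradicting nonsingularity, so connectedness leaves
      a single sign throughout.\<close>
    let ?P = "interior {t\<in>{a<..<b}. 0 \<le> \<phi> t $ i}" and ?N = "interior {t\<in>{a<..<b}. \<phi> t $ i \<le> 0}"
    have "{a<..<b} \<subseteq> ?P \<union> ?N"
    proof
      fix s assume "s \<in> {a<..<b}"
      from local[OF this, of i] obtain V where V: "open V" "s \<in> V"
          "V \<subseteq> {t\<in>{a<..<b}. 0 \<le> \<phi> t $ i} \<or> V \<subseteq> {t\<in>{a<..<b}. \<phi> t $ i \<le> 0}"
        by blast
      then show "s \<in> ?P \<union> ?N"
        by (auto intro: interiorI)
    qed
    moreover have "?P \<inter> ?N = {}"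
    proof (rule ccontr)
      assume "?P \<inter> ?N \<noteq> {}"
      moreover have "AE t\<in>{a<..<b} in lebesgue. \<phi> t $ i \<noteq> 0"
        using nonzero by (simp add: nonsingular_on_def)
      moreover have "?P \<inter> ?N \<subseteq> {t\<in>{a<..<b}. 0 \<le> \<phi> t $ i} \<inter> {t\<in>{a<..<b}. \<phi> t $ i \<le> 0}"
        by (intro Int_mono interior_subset)
      ultimately obtain t where "t \<in> ?P \<inter> ?N" "\<phi> t $ i \<noteq> 0"
        by (elim AE_lebesgue_open_ex[of _ _ "?P \<inter> ?N"]) auto
      with \<open>?P \<inter> ?N \<subseteq> _\<close> show False
        by force
    qed
    ultimately have "?P \<inter> {a<..<b} = {} \<or> ?N \<inter> {a<..<b} = {}"
      by (intro connectedD) auto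
    then have "{a<..<b} \<subseteq> ?P \<or> {a<..<b} \<subseteq> ?N"
      using \<open>{a<..<b} \<subseteq> ?P \<union> ?N\<close> by blast
    then show ?thesis
    proof
      assume "{a<..<b} \<subseteq> ?P"
      from subset_trans[OF this interior_subset] show ?thesis
        by (intro exI[of _ 1]) auto
    next
      assume "{a<..<b} \<subseteq> ?N"
      from subset_trans[OF this interior_subset] show ?thesis
        by (intro exI[of _ "-1"]) auto
    qed
  qed
  then obtain \<sigma> where \<sigma>: "\<And>i. \<bar>\<sigma> i\<bar> = 1" "\<And>i t. t \<in> {a<..<b} \<Longrightarrow> 0 \<le> \<phi> t $ i * \<sigma> i"
    by metis
  \<comment> \<open>There are finitely many components, so their exceptional null sets can be
    united.\<close>
  have "AE t in lebesgue. \<forall>i. t \<in> {a<..<b} \<longrightarrow> \<phi> t $ i \<noteq> 0"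
    using nonzero by (intro eventually_all_finite) (simp add: nonsingular_on_def)
  with max have "AE t\<in>{a<..<b} in lebesgue. u t = (\<chi> i. \<sigma> i)"
  proof eventually_elim
    case (elim t)
    show ?case
    proof
      assume t: "t \<in> {a<..<b}"
      have "u t $ i = \<sigma> i" for i
      proof -
        have "u t $ i = sgn (\<phi> t $ i)"
          using elim t by (intro bang) auto
        also have "\<dots> = \<sigma> i"
          using elim t \<sigma>(1)[of i] \<sigma>(2)[OF t, of i] by (auto simp: abs_if sgn_if zero_le_mult_iff split: if_splits)
        finally show ?thesis .
      qed
      then show "u t = (\<chi> i. \<sigma> i)"
        by (simp add: vec_eq_iff)
    qed
  qed
  with \<sigma> that[of "\<chi> i. \<sigma> i"] show thesis
    by simp
qed

section \<open>Extremals as solutions of the Hamiltonian system\<close>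

lemma extremal_has_vector_derivativeD:
  fixes T M :: "real^'n^'n" and Q c :: "real^'n \<Rightarrow> real"
  assumes T: "transpose T = T" and Q: "C_infinity Q" and c: "C_infinity c"
    and ode: "((\<lambda>t. (x t, v t, p\<^sub>1 t, p\<^sub>2 t)) has_vector_derivative
        extremal_field T M Q c l (x t, v t, p\<^sub>1 t, p\<^sub>2 t) w) (at t)"
  shows "(x has_vector_derivative T *v v t) (at t) \<and>
      (v has_vector_derivative force Q (x t) + M *v w) (at t) \<and>
      (p\<^sub>1 has_vector_derivative l *\<^sub>R grad c (x t) + force_hessian Q (x t) *v p\<^sub>2 t) (at t) \<and>
      (p\<^sub>2 has_vector_derivative - (T *v p\<^sub>1 t)) (at t)"
proof -
  have split: "(f has_vector_derivative fst d) (at t) \<and> (g has_vector_derivative snd d) (at t)"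
    if "((\<lambda>t. (f t, g t)) has_vector_derivative d) (at t)"
    for f :: "real \<Rightarrow> 'a::real_normed_vector" and g :: "real \<Rightarrow> 'b::real_normed_vector" and d t
    using has_derivative_fst[OF that[unfolded has_vector_derivative_def]]
      has_derivative_snd[OF that[unfolded has_vector_derivative_def]]
    by (simp add: has_vector_derivative_def)
  show ?thesis
    using ode by (auto simp: extremal_field_eq[OF Q c T] dest!: split)
qed

lemma continuous_on_grad_compose:
  assumes "C_infinity f" "continuous_on S x"
  shows "continuous_on S (\<lambda>t. grad f (x t))"
  unfolding grad_eq using assms
  by (intro continuous_on_vec_lambda continuous_on_C_infinity_compose C_infinity_partial_deriv)

text \<open>A constant control makes the right-hand side continuous along the trajectory, so the
  almost-everywhere equations hold at every time. This includes one-sided derivatives at the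
  junction, an endpoint of the arc.\<close>

lemma extremal_has_vector_derivative:
  fixes T M :: "real^'n^'n" and Q c :: "real^'n \<Rightarrow> real"
  assumes T: "transpose T = T" and Q: "C_infinity Q" and c: "C_infinity c"
    and ac: "abs_continuous_on {a..b} x" "abs_continuous_on {a..b} v"
      "abs_continuous_on {a..b} p\<^sub>1" "abs_continuous_on {a..b} p\<^sub>2"
    and ode: "AE t\<in>{a<..<b} in lebesgue.
      ((\<lambda>t. (x t, v t, p\<^sub>1 t, p\<^sub>2 t)) has_vector_derivative
        extremal_field T M Q c l (x t, v t, p\<^sub>1 t, p\<^sub>2 t) (u t)) (at t)"
    and w: "AE t\<in>{a<..<b} in lebesgue. u t = w" and t: "t \<in> {a..b}"
  shows "((\<lambda>t. (x t, v t, p\<^sub>1 t, p\<^sub>2 t)) has_vector_derivative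
    extremal_field T M Q c l (x t, v t, p\<^sub>1 t, p\<^sub>2 t) w) (at t within {a..b})"
proof -
  have ae: "AE t\<in>{a<..<b} in lebesgue. (x has_vector_derivative T *v v t) (at t) \<and>
      (v has_vector_derivative force Q (x t) + M *v w) (at t) \<and>
      (p\<^sub>1 has_vector_derivative l *\<^sub>R grad c (x t) + force_hessian Q (x t) *v p\<^sub>2 t) (at t) \<and>
      (p\<^sub>2 has_vector_derivative - (T *v p\<^sub>1 t)) (at t)"
    using ode w
  proof eventually_elim
    case (elim t)
    show ?case
      using elim extremal_has_vector_derivativeD[OF T Q c] by auto
  qed
  have cont: "continuous_on {a..b} x" "continuous_on {a..b} v"
    "continuous_on {a..b} p\<^sub>1" "continuous_on {a..b} p\<^sub>2"
    using ac by (simp_all add: abs_continuous_on_imp_continuous_on)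
  have fh: "continuous_on {a..b} (\<lambda>t. force_hessian Q (x t) *v p\<^sub>2 t)"
    unfolding force_hessian_def matrix_vector_mult_def vec_lambda_beta
    by (intro continuous_on_vec_lambda continuous_on_sum continuous_on_mult continuous_on_component
        cont continuous_on_C_infinity_compose C_infinity_partial_deriv Q)
  have "(x has_vector_derivative T *v v t) (at t within {a..b})"
    using ae by (intro abs_continuous_on_has_vector_derivative ac t continuous_on_matrix_vector_mult cont)
      (auto elim: eventually_mono)
  moreover have "(v has_vector_derivative force Q (x t) + M *v w) (at t within {a..b})"
    using ae unfolding force_def
    by (intro abs_continuous_on_has_vector_derivative ac t continuous_on_add continuous_on_minus
        continuous_on_const continuous_on_grad_compose cont Q)
      (auto elim: eventually_mono)
  moreover have "(p\<^sub>1 has_vector_derivative l *\<^sub>R grad c (x t) + force_hessian Q (x t) *v p\<^sub>2 t)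
      (at t within {a..b})"
    using ae by (intro abs_continuous_on_has_vector_derivative ac t continuous_on_add continuous_on_scaleR
        continuous_on_const continuous_on_grad_compose cont fh c)
      (auto elim: eventually_mono)
  moreover have "(p\<^sub>2 has_vector_derivative - (T *v p\<^sub>1 t)) (at t within {a..b})"
    using ae by (intro abs_continuous_on_has_vector_derivative ac t continuous_on_minus
        continuous_on_matrix_vector_mult cont) (auto elim: eventually_mono)
  ultimately show ?thesis
    by (simp add: extremal_field_eq[OF Q c T] has_vector_derivative_Pair)
qed

section \<open>Nonsingular arcs touching the origin, singular arcs resting there\<close>

text \<open>Otherwise the control is a constant sign vector \<open>w\<close> with
  \<open>w \<bullet> \<phi>\<close> nonnegative, against the fourth-order behavior. Applied to ever
  shorter arcs at the junction, this yields accumulation.\<close>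

lemma control_discontinuous_near_origin:
  fixes T M :: "real^'n^'n" and Q c :: "real^'n \<Rightarrow> real"
  assumes T: "transpose T = T" "invertible T" and M: "transpose M = M" "invertible M"
    and Q: "C_infinity Q" and c: "C_infinity c" and "force Q 0 = 0" and "grad c 0 = 0"
    and "positive_definite (hessian c 0)"
    and ac: "abs_continuous_on {a..b} x" "abs_continuous_on {a..b} v"
      "abs_continuous_on {a..b} p\<^sub>1" "abs_continuous_on {a..b} p\<^sub>2"
    and ode: "AE t\<in>{a<..<b} in lebesgue.
      ((\<lambda>t. (x t, v t, p\<^sub>1 t, p\<^sub>2 t)) has_vector_derivative
        extremal_field T M Q c 1 (x t, v t, p\<^sub>1 t, p\<^sub>2 t) (u t)) (at t)"
    and max: "AE t\<in>{a<..<b} in lebesgue. \<forall>i. \<bar>switching_function M p\<^sub>2 t $ i\<bar>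
      \<le> switching_function M p\<^sub>2 t $ i * u t $ i \<and> \<bar>u t $ i\<bar> \<le> 1"
    and nonsing: "nonsingular_on (switching_function M p\<^sub>2) {a<..<b}"
    and "a < b" and t\<^sub>c: "t\<^sub>c \<in> {a, b}" and zero: "x t\<^sub>c = 0" "v t\<^sub>c = 0" "p\<^sub>1 t\<^sub>c = 0" "p\<^sub>2 t\<^sub>c = 0"
  shows "\<exists>s\<in>{a<..<b}. control_discontinuous_at u s"
proof (rule ccontr)
  assume "\<not> ?thesis"
  then have cont: "\<not> control_discontinuous_at u s" if "s \<in> {a<..<b}" for s
    using that by blast
  have "continuous_on {a..b} p\<^sub>2"
    using ac(4) by (rule abs_continuous_on_imp_continuous_on)
  then have "continuous_on {a<..<b} (switching_function M p\<^sub>2)"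
    unfolding switching_function_def[abs_def]
    by (intro continuous_on_matrix_vector_mult) (erule continuous_on_subset, auto)
  from continuous_bang_control_constant[OF this nonsing max cont] obtain w where
    w: "\<And>i. \<bar>w $ i\<bar> = 1" "AE t\<in>{a<..<b} in lebesgue. u t = w"
      "\<And>t i. t \<in> {a<..<b} \<Longrightarrow> 0 \<le> switching_function M p\<^sub>2 t $ i * w $ i"
    by blast
  \<comment> \<open>Orients time so that growing \<open>s\<close> leads from
    \<open>t\<^sub>c\<close> into the arc: forward from the left endpoint, backward from the right
    one.\<close>
  define \<sigma> :: real where "\<sigma> = (if t\<^sub>c = a then 1 else -1)"
  let ?z = "\<lambda>t. (x t, v t, p\<^sub>1 t, p\<^sub>2 t)" and ?F = "extremal_field T M Q c 1"
  have range: "t\<^sub>c + \<sigma> * s \<in> {a..b}" if "s \<in> {0..b - a}" for s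
    using that t\<^sub>c \<open>a < b\<close> by (auto simp: \<sigma>_def)
  have deriv: "((\<lambda>s. ?z (t\<^sub>c + \<sigma> * s)) has_vector_derivative
      \<sigma> *\<^sub>R ?F (?z (t\<^sub>c + \<sigma> * s)) w) (at s within {0..b - a})"
    if s: "s \<in> {0..b - a}" for s
  proof -
    have "((\<lambda>s. t\<^sub>c + \<sigma> * s) has_vector_derivative \<sigma>) (at s within {0..b - a})"
      by (auto intro!: derivative_eq_intros)
    moreover have "(?z has_vector_derivative ?F (?z (t\<^sub>c + \<sigma> * s)) w)
        (at (t\<^sub>c + \<sigma> * s) within (\<lambda>s. t\<^sub>c + \<sigma> * s) ` {0..b - a})"
      using extremal_has_vector_derivative[OF T(1) Q c ac ode w(2) range[OF s]]
      by (rule has_vector_derivative_within_subset) (use range in auto)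
    ultimately show ?thesis
      using vector_diff_chain_within by (force simp: o_def)
  qed
  have "w \<noteq> 0"
    using w(1) by force
  have "\<sigma> \<in> {-1, 1}" "0 < b - a"
    using \<open>a < b\<close> by (auto simp: \<sigma>_def)
  obtain s where s: "s \<in> {0<..<b - a}" "w \<bullet> (M *v snd (snd (snd (?z (t\<^sub>c + \<sigma> * s))))) < 0"
    by (rule constant_control_from_origin[where z = ?z and t\<^sub>c = t\<^sub>c and M = M and w = w,
          OF T M Q c assms(7-9) \<open>0 < b - a\<close> \<open>\<sigma> \<in> _\<close> \<open>w \<noteq> 0\<close> _ deriv])
      (simp_all add: zero zero_prod_def)
  have "t\<^sub>c + \<sigma> * s \<in> {a<..<b}"
    using s(1) t\<^sub>c by (auto simp: \<sigma>_def)
  then have "0 \<le> w \<bullet> switching_function M p\<^sub>2 (t\<^sub>c + \<sigma> * s)"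
    unfolding inner_vec_def using w(3) by (intro sum_nonneg) (simp add: mult.commute)
  with s(2) show False
    by (simp add: switching_function_def)
qed

text \<open>Vanishing passes from a function to its derivative, down the chain
  \<open>p\<^sub>2\<close>, \<open>p\<^sub>1\<close>, \<open>grad c (x t)\<close>, \<open>x\<close>,
  \<open>v\<close>. The open set gives two-sided derivatives; continuity extends the result to the
  closure, where the junction lies.\<close>

lemma singular_imp_origin:
  fixes T M :: "real^'n^'n" and Q c :: "real^'n \<Rightarrow> real"
  assumes T: "transpose T = T" "invertible T" and M: "invertible M"
    and Q: "C_infinity Q" and c: "C_infinity c" and "grad c 0 = 0"
    and "\<And>y. positive_definite (hessian c y)" and "l \<in> {0, 1}"
    and cont: "continuous_on (closure U) x" "continuous_on (closure U) v"
      "continuous_on (closure U) p\<^sub>1" "continuous_on (closure U) p\<^sub>2"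
    and U: "open U" "U \<noteq> {}"
    and nontrivial: "\<And>t. t \<in> U \<Longrightarrow> (l, p\<^sub>1 t, p\<^sub>2 t) \<noteq> (0, 0, 0)"
    and ode: "AE t\<in>U in lebesgue.
      ((\<lambda>t. (x t, v t, p\<^sub>1 t, p\<^sub>2 t)) has_vector_derivative
        extremal_field T M Q c l (x t, v t, p\<^sub>1 t, p\<^sub>2 t) (u t)) (at t)"
    and singular: "singular_on (switching_function M p\<^sub>2) U"
  shows "l = 1" "\<And>t. t \<in> closure U \<Longrightarrow> x t = 0 \<and> v t = 0 \<and> p\<^sub>1 t = 0 \<and> p\<^sub>2 t = 0"
proof -
  have contU: "continuous_on U x" "continuous_on U v" "continuous_on U p\<^sub>1" "continuous_on U p\<^sub>2"
    using cont closure_subset by (auto intro: continuous_on_subset)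
  have ae: "AE t\<in>U in lebesgue. (x has_vector_derivative T *v v t) (at t)"
    "AE t\<in>U in lebesgue.
      (p\<^sub>1 has_vector_derivative l *\<^sub>R grad c (x t) + force_hessian Q (x t) *v p\<^sub>2 t) (at t)"
    "AE t\<in>U in lebesgue. (p\<^sub>2 has_vector_derivative - (T *v p\<^sub>1 t)) (at t)"
    using ode by (eventually_elim, use extremal_has_vector_derivativeD[OF T(1) Q c] in blast)+
  have p2: "p\<^sub>2 t = 0" if "t \<in> U" for t
  proof -
    have "M *v p\<^sub>2 t = 0"
      using singular that by (simp add: singular_on_def switching_function_def vec_eq_iff)
    then show ?thesis
      by (simp add: invertible_matrix_vector_eq_0_iff[OF M])
  qed
  have p1: "p\<^sub>1 t = 0" if "t \<in> U" for t
  proof -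
    have "continuous_on U (\<lambda>t. - (T *v p\<^sub>1 t))"
      by (intro continuous_on_minus continuous_on_matrix_vector_mult contU)
    from zero_imp_derivative_zero[OF ae(3) U(1) p2 this that] show ?thesis
      using T by (simp add: invertible_matrix_vector_eq_0_iff)
  qed
  show l: "l = 1"
    using \<open>l \<in> {0, 1}\<close> U(2) p1 p2 nontrivial by force
  \<comment> \<open>With \<open>p\<^sub>2 = 0\<close> and \<open>l = 1\<close> only the cost
    gradient is left in the adjoint equation, and it is continuous in time.\<close>
  have "AE t\<in>U in lebesgue. (p\<^sub>1 has_vector_derivative grad c (x t)) (at t)"
    using ae(2) by eventually_elim (simp add: p2 l)
  from zero_imp_derivative_zero[OF this U(1) p1 continuous_on_grad_compose[OF c contU(1)]]
  have "grad c (x t) = 0" if "t \<in> U" for t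
    using that by blast
  then have x: "x t = 0" if "t \<in> U" for t
    using that grad_eq_0_iff[OF c \<open>grad c 0 = 0\<close> assms(7)] by blast
  have v: "v t = 0" if "t \<in> U" for t
    using zero_imp_derivative_zero[OF ae(1) U(1) x continuous_on_matrix_vector_mult[OF contU(2)] that]
      T by (simp add: invertible_matrix_vector_eq_0_iff)
  show "x t = 0 \<and> v t = 0 \<and> p\<^sub>1 t = 0 \<and> p\<^sub>2 t = 0" if "t \<in> closure U" for t
    using cont[THEN continuous_constant_on_closure] x v p1 p2 that by blast
qed

text \<open>Rest at the origin gives \<open>M u = 0\<close> almost everywhere, hence
  \<open>u = 0\<close>, and the maximality inequality then bounds every component of
  \<open>\<phi>\<close> by 0. Continuity removes the exceptional null set.\<close>

lemma origin_imp_singular: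
  fixes T M :: "real^'n^'n" and Q c :: "real^'n \<Rightarrow> real"
  assumes T: "transpose T = T" and M: "invertible M" and Q: "C_infinity Q" and c: "C_infinity c"
    and "force Q 0 = 0" and cont: "continuous_on (closure U) p\<^sub>2" and U: "open U"
    and ode: "AE t\<in>U in lebesgue.
      ((\<lambda>t. (x t, v t, p\<^sub>1 t, p\<^sub>2 t)) has_vector_derivative
        extremal_field T M Q c l (x t, v t, p\<^sub>1 t, p\<^sub>2 t) (u t)) (at t)"
    and max: "AE t\<in>U in lebesgue. \<forall>i. \<bar>switching_function M p\<^sub>2 t $ i\<bar>
      \<le> switching_function M p\<^sub>2 t $ i * u t $ i \<and> \<bar>u t $ i\<bar> \<le> 1"
    and zero: "\<And>t. t \<in> U \<Longrightarrow> x t = 0 \<and> v t = 0"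
  shows "singular_on (switching_function M p\<^sub>2) (closure U)"
proof -
  let ?\<phi> = "switching_function M p\<^sub>2"
  have \<phi>: "continuous_on (closure U) ?\<phi>"
    unfolding switching_function_def[abs_def] using cont by (rule continuous_on_matrix_vector_mult)
  have "AE t\<in>U in lebesgue. (v has_vector_derivative force Q (x t) + M *v u t) (at t)"
    using ode by eventually_elim (use extremal_has_vector_derivativeD[OF T Q c] in blast)
  from zero_imp_AE_derivative_zero[OF this U] zero
  have "AE t\<in>U in lebesgue. force Q (x t) + M *v u t = 0"
    by blast
  with max have "AE t\<in>U in lebesgue. ?\<phi> t = 0"
  proof eventually_elim
    case (elim t)
    show ?case
    proof
      assume t: "t \<in> U"
      then have "u t = 0"
        using elim zero \<open>force Q 0 = 0\<close> by (simp add: invertible_matrix_vector_eq_0_iff[OF M])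
      then show "?\<phi> t = 0"
        using elim t by (simp add: vec_eq_iff)
    qed
  qed
  then have "?\<phi> t = 0" if "t \<in> U" for t
    using continuous_AE_zero_imp_zero[OF _ U continuous_on_subset[OF \<phi> closure_subset] that] by blast
  then have "?\<phi> t = 0" if "t \<in> closure U" for t
    using continuous_constant_on_closure[OF \<phi>] that by blast
  then show ?thesis
    by (simp add: singular_on_def)
qed

section \<open>Assembly along the prolonged trajectory: singular intervals, then junctions\<close>

theorem mainTheorem6:
  fixes T M :: "real^'n^'n" and Q c :: "real^'n \<Rightarrow> real"
    and a b :: "real^'n" and T\<^sub>f S l :: real
    and x v u p\<^sub>1 p\<^sub>2 :: "real \<Rightarrow> real^'n"
  assumes "transpose T = T" and "positive_definite T"
    and "transpose M = M" and "invertible M"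
    and "C_infinity Q" and "C_infinity c"
    and "force Q 0 = 0"
    and "\<And>y. c y = 0 \<longleftrightarrow> y = 0"
    and "grad c 0 = 0" and "\<And>y. positive_definite (hessian c y)"
    and opt: "optimal T M Q c a b T\<^sub>f x v u"
    and prolonged: "T\<^sub>f \<le> S" "\<And>t. t \<in> {T\<^sub>f<..S} \<Longrightarrow> x t = 0 \<and> v t = 0 \<and> u t = 0"
    and lift: "pontryagin_lift T M Q c S x v u l p\<^sub>1 p\<^sub>2"
  shows "(\<forall>I. is_interval I \<and> interior I \<noteq> {} \<and> I \<subseteq> {0..S} \<longrightarrow>
            (singular_on (switching_function M p\<^sub>2) I \<longleftrightarrow> (\<forall>t\<in>I. (x t, v t) = (0, 0)))) \<and>
         (\<forall>t\<^sub>c. junction S (switching_function M p\<^sub>2) t\<^sub>c \<longrightarrow>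
            junction_order T M Q c l (\<lambda>t. (x t, v t, p\<^sub>1 t, p\<^sub>2 t)) t\<^sub>c 2 \<and>
            \<not> analytic_junction u t\<^sub>c \<and>
            fuller_phenomenon u t\<^sub>c)"
proof -
  let ?\<phi> = "switching_function M p\<^sub>2"
  have T: "transpose T = T" "invertible T" and M: "transpose M = M" "invertible M"
    and Q: "C_infinity Q" and c: "C_infinity c" and Q0: "force Q 0 = 0" and c0: "grad c 0 = 0"
    and hess: "\<And>y. positive_definite (hessian c y)"
    using assms(1-10) positive_definite_imp_invertible by auto
  have adm: "0 \<le> T\<^sub>f" "\<And>t. t \<in> {0..T\<^sub>f} \<Longrightarrow> u t \<in> control_box"
    "abs_continuous_on {0..T\<^sub>f} x" "abs_continuous_on {0..T\<^sub>f} v" "x T\<^sub>f = 0" "v T\<^sub>f = 0"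
    "AE t\<in>{0..T\<^sub>f} in lebesgue.
        (x has_vector_derivative T *v v t) (at t within {0..T\<^sub>f}) \<and>
        (v has_vector_derivative force Q (x t) + M *v u t) (at t within {0..T\<^sub>f})"
    using opt unfolding optimal_def admissible_def by auto
  have lift': "l \<in> {0, 1}" "abs_continuous_on {0..S} p\<^sub>1" "abs_continuous_on {0..S} p\<^sub>2"
    "\<And>t. t \<in> {0..S} \<Longrightarrow> (l, p\<^sub>1 t, p\<^sub>2 t) \<noteq> (0, 0, 0)"
    using lift unfolding pontryagin_lift_def by blast+
  have u: "u t \<in> control_box" if "t \<in> {0..S}" for t
    using that adm(2) prolonged(2) by (cases "t \<le> T\<^sub>f") (auto simp: control_box_def)
  have at_rest: "x t = 0 \<and> v t = 0" if "t \<in> {T\<^sub>f..S}" for t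
    using that adm(5,6) prolonged(2) by (cases "t = T\<^sub>f") auto
  \<comment> \<open>The state is absolutely continuous on \<open>{0..T\<^sub>f}\<close> by
    admissibility and known only as zero afterwards; the two pieces agree at
    \<open>T\<^sub>f\<close>.\<close>
  have glue: "continuous_on {0..S} f"
    if "continuous_on {0..T\<^sub>f} f" "\<And>t. t \<in> {T\<^sub>f..S} \<Longrightarrow> f t = 0" for f :: "real \<Rightarrow> real^'n"
  proof -
    have "continuous_on {T\<^sub>f..S} f"
      by (rule continuous_on_eq[of _ "\<lambda>_. 0"]) (simp_all add: that(2))
    with that(1) have "continuous_on ({0..T\<^sub>f} \<union> {T\<^sub>f..S}) f"
      by (intro continuous_on_closed_Un) auto
    then show ?thesis
      using adm(1) prolonged(1) by (simp add: ivl_disj_un_two_touch)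
  qed
  have cont: "continuous_on {0..S} x" "continuous_on {0..S} v"
    "continuous_on {0..S} p\<^sub>1" "continuous_on {0..S} p\<^sub>2"
  proof -
    show "continuous_on {0..S} x"
      by (rule glue[OF adm(3)[THEN abs_continuous_on_imp_continuous_on]]) (simp add: at_rest)
    show "continuous_on {0..S} v"
      by (rule glue[OF adm(4)[THEN abs_continuous_on_imp_continuous_on]]) (simp add: at_rest)
  qed (rule lift'(2,3)[THEN abs_continuous_on_imp_continuous_on])+
  \<comment> \<open>The instant \<open>T\<^sub>f\<close> is discarded as null. After it state and
    control are zero, which solves the dynamics because the force vanishes at the origin.\<close>
  have state: "AE t\<in>{0<..<S} in lebesgue. (x has_vector_derivative T *v v t) (at t) \<and>
      (v has_vector_derivative force Q (x t) + M *v u t) (at t)"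
  proof -
    have "AE t in lebesgue. t \<noteq> T\<^sub>f"
      by (auto intro!: AE_lborel_singleton AE_completion)
    with adm(7) show ?thesis
    proof eventually_elim
      case (elim t)
      show ?case
      proof
        assume t: "t \<in> {0<..<S}"
        show "(x has_vector_derivative T *v v t) (at t) \<and>
            (v has_vector_derivative force Q (x t) + M *v u t) (at t)"
        proof (cases "t < T\<^sub>f")
          case True
          then show ?thesis
            using elim t by (simp add: at_within_Icc_at)
        next
          case False
          with elim t have tf: "t \<in> {T\<^sub>f<..<S}"
            by auto
          have zero: "(f has_vector_derivative 0) (at t)"
            if "\<And>r. r \<in> {T\<^sub>f<..<S} \<Longrightarrow> f r = 0" for f :: "real \<Rightarrow> real^'n"
            by (rule has_vector_derivative_transform_within_open[OF has_vector_derivative_const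
                  open_greaterThanLessThan tf]) (simp add: that)
          show ?thesis
            using zero[of x] zero[of v] at_rest prolonged(2)[of t] tf Q0 by simp
        qed
      qed
    qed
  qed
  have ode: "AE t\<in>{0<..<S} in lebesgue.
      ((\<lambda>t. (x t, v t, p\<^sub>1 t, p\<^sub>2 t)) has_vector_derivative
        extremal_field T M Q c l (x t, v t, p\<^sub>1 t, p\<^sub>2 t) (u t)) (at t)"
    using state lift[unfolded pontryagin_lift_def, THEN conjunct2, THEN conjunct2, THEN conjunct2, THEN conjunct2]
  proof eventually_elim
    case (elim t)
    then show ?case
      by (auto simp: extremal_field_def at_within_Icc_at intro!: has_vector_derivative_Pair)
  qed
  have max: "AE t\<in>{0<..<S} in lebesgue. \<forall>i. \<bar>?\<phi> t $ i\<bar> \<le> ?\<phi> t $ i * u t $ i \<and> \<bar>u t $ i\<bar> \<le> 1"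
    using lift[unfolded pontryagin_lift_def, THEN conjunct2, THEN conjunct2, THEN conjunct2, THEN conjunct2]
  proof eventually_elim
    case (elim t)
    show ?case
    proof (intro impI allI)
      fix i assume t: "t \<in> {0<..<S}"
      \<comment> \<open>Only \<open>p\<^sub>2 \<bullet> (M *v w)\<close> depends on the control in
        the Hamiltonian; symmetry of \<open>M\<close> turns it into the pairing with
        \<open>\<phi>\<close>.\<close>
      have "?\<phi> t \<bullet> w \<le> ?\<phi> t \<bullet> u t" if "w \<in> control_box" for w
        using elim t that
        by (auto simp: hamiltonian_def inner_add_right switching_function_def symmetric_matrix_inner[OF M(1)])
      with u[of t] t show "\<bar>?\<phi> t $ i\<bar> \<le> ?\<phi> t $ i * u t $ i \<and> \<bar>u t $ i\<bar> \<le> 1"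
        by (auto intro: maximal_on_control_box simp: control_box_def)
    qed
  qed
  have open_sub: "U \<subseteq> {0<..<S}" if "open U" "U \<subseteq> {0..S}" for U
    using interior_maximal[OF that(2,1)] by simp
  have closure_sub: "closure U \<subseteq> {0..S}" if "U \<subseteq> {0..S}" for U
    using that by (rule closure_minimal) simp
  have singular: "l = 1 \<and> (\<forall>t\<in>closure U. x t = 0 \<and> v t = 0 \<and> p\<^sub>1 t = 0 \<and> p\<^sub>2 t = 0)"
    if U: "open U" "U \<noteq> {}" "U \<subseteq> {0..S}" and "singular_on ?\<phi> U" for U
    using singular_imp_origin[OF T M(2) Q c c0 hess lift'(1)
        cont[THEN continuous_on_subset, OF closure_sub[OF U(3)]] U(1,2) _
        AE_subset[OF ode open_sub[OF U(1,3)]] \<open>singular_on ?\<phi> U\<close>] lift'(4) U(3)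
    by blast
  have part_i: "singular_on ?\<phi> I \<longleftrightarrow> (\<forall>t\<in>I. (x t, v t) = (0, 0))"
    if I: "is_interval I" "interior I \<noteq> {}" "I \<subseteq> {0..S}" for I
  proof -
    \<comment> \<open>A convex set with nonempty interior lies in the closure of its interior, so
      the results for open sets reach the endpoints of \<open>I\<close>.\<close>
    have sub: "I \<subseteq> closure (interior I)"
      using I by (simp add: convex_closure_interior is_interval_convex closure_subset)
    have U: "open (interior I)" "interior I \<subseteq> I" "interior I \<subseteq> {0..S}"
      using I interior_subset by auto
    show ?thesis
    proof
      assume "singular_on ?\<phi> I"
      then have "singular_on ?\<phi> (interior I)"
        using U(2) by (auto simp: singular_on_def)
      from singular[OF U(1) I(2) U(3) this] sub show "\<forall>t\<in>I. (x t, v t) = (0, 0)"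
        by auto
    next
      assume "\<forall>t\<in>I. (x t, v t) = (0, 0)"
      with U(2) have "\<And>t. t \<in> interior I \<Longrightarrow> x t = 0 \<and> v t = 0"
        by auto
      from origin_imp_singular[OF T(1) M(2) Q c Q0 continuous_on_subset[OF cont(4) closure_sub[OF U(3)]]
          U(1) AE_subset[OF ode open_sub[OF U(1,3)]] AE_subset[OF max open_sub[OF U(1,3)]] this]
      show "singular_on ?\<phi> I"
        using sub by (auto simp: singular_on_def)
    qed
  qed
  have nonsingular: "\<exists>s\<in>{\<alpha><..<\<beta>}. control_discontinuous_at u s"
    if \<alpha>\<beta>: "0 \<le> \<alpha>" "\<alpha> < \<beta>" "\<beta> \<le> S" and nonsing: "nonsingular_on ?\<phi> {\<alpha><..<\<beta>}" and "l = 1"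
      and t\<^sub>c: "t\<^sub>c \<in> {\<alpha>, \<beta>}" "x t\<^sub>c = 0" "v t\<^sub>c = 0" "p\<^sub>1 t\<^sub>c = 0" "p\<^sub>2 t\<^sub>c = 0" for \<alpha> \<beta> t\<^sub>c
  proof -
    have sub: "{\<alpha><..<\<beta>} \<subseteq> {0<..<S}"
      using \<alpha>\<beta> by auto
    \<comment> \<open>Absolute continuity of the state is at hand only up to
      \<open>T\<^sub>f\<close>. Past that time \<open>u = 0\<close>, so maximality would force
      \<open>\<phi> = 0\<close> on part of a nonsingular arc.\<close>
    have "\<beta> \<le> T\<^sub>f"
    proof (rule ccontr)
      assume "\<not> \<beta> \<le> T\<^sub>f"
      have "AE t\<in>{\<alpha><..<\<beta>} in lebesgue. \<forall>i. ?\<phi> t $ i \<noteq> 0 \<and> \<bar>?\<phi> t $ i\<bar> \<le> ?\<phi> t $ i * u t $ i"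
      proof -
        have "AE t in lebesgue. \<forall>i. t \<in> {\<alpha><..<\<beta>} \<longrightarrow> ?\<phi> t $ i \<noteq> 0"
          using nonsing by (intro eventually_all_finite) (simp add: nonsingular_on_def)
        with AE_subset[OF max sub] show ?thesis
          by eventually_elim auto
      qed
      moreover have "{max \<alpha> T\<^sub>f<..<\<beta>} \<noteq> {}" "{max \<alpha> T\<^sub>f<..<\<beta>} \<subseteq> {\<alpha><..<\<beta>}"
        using \<alpha>\<beta> \<open>\<not> \<beta> \<le> T\<^sub>f\<close> by auto
      ultimately obtain t where "t \<in> {max \<alpha> T\<^sub>f<..<\<beta>}"
          "\<forall>i. ?\<phi> t $ i \<noteq> 0 \<and> \<bar>?\<phi> t $ i\<bar> \<le> ?\<phi> t $ i * u t $ i"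
        by (rule AE_lebesgue_open_ex[OF _ open_greaterThanLessThan])
      moreover from this(1) have "u t = 0"
        using prolonged(2)[of t] \<alpha>\<beta> by auto
      ultimately show False
        by simp
    qed
    then have "{\<alpha>..\<beta>} \<subseteq> {0..T\<^sub>f}" "{\<alpha>..\<beta>} \<subseteq> {0..S}"
      using \<alpha>\<beta> by auto
    note ac = abs_continuous_on_subset[OF adm(3) this(1)] abs_continuous_on_subset[OF adm(4) this(1)]
      abs_continuous_on_subset[OF lift'(2) this(2)] abs_continuous_on_subset[OF lift'(3) this(2)]
    show ?thesis
      by (rule control_discontinuous_near_origin[OF T M Q c Q0 c0 hess ac
            AE_subset[OF ode[unfolded \<open>l = 1\<close>] sub] AE_subset[OF max sub] nonsing \<alpha>\<beta>(2) t\<^sub>c])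
  qed
  have part_ii: "junction_order T M Q c l (\<lambda>t. (x t, v t, p\<^sub>1 t, p\<^sub>2 t)) t\<^sub>c 2 \<and>
      \<not> analytic_junction u t\<^sub>c \<and> fuller_phenomenon u t\<^sub>c" if "junction S ?\<phi> t\<^sub>c" for t\<^sub>c
  proof -
    obtain \<alpha> \<beta> where \<alpha>\<beta>: "0 \<le> \<alpha>" "\<alpha> < t\<^sub>c" "t\<^sub>c < \<beta>" "\<beta> \<le> S"
      and arcs: "singular_on ?\<phi> {\<alpha><..<t\<^sub>c} \<and> nonsingular_on ?\<phi> {t\<^sub>c<..<\<beta>} \<or>
         nonsingular_on ?\<phi> {\<alpha><..<t\<^sub>c} \<and> singular_on ?\<phi> {t\<^sub>c<..<\<beta>}"
      using \<open>junction S ?\<phi> t\<^sub>c\<close> unfolding junction_def by blast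
    \<comment> \<open>Whichever side is singular, the junction time lies in the closure of that
      side.\<close>
    have "l = 1 \<and> x t\<^sub>c = 0 \<and> v t\<^sub>c = 0 \<and> p\<^sub>1 t\<^sub>c = 0 \<and> p\<^sub>2 t\<^sub>c = 0"
      using arcs
    proof
      assume "singular_on ?\<phi> {\<alpha><..<t\<^sub>c} \<and> nonsingular_on ?\<phi> {t\<^sub>c<..<\<beta>}"
      with singular[of "{\<alpha><..<t\<^sub>c}"] \<alpha>\<beta> show ?thesis
        by (auto simp: subset_iff)
    next
      assume "nonsingular_on ?\<phi> {\<alpha><..<t\<^sub>c} \<and> singular_on ?\<phi> {t\<^sub>c<..<\<beta>}"
      with singular[of "{t\<^sub>c<..<\<beta>}"] \<alpha>\<beta> show ?thesis
        by (auto simp: subset_iff)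
    qed
    then have l: "l = 1" and zero: "x t\<^sub>c = 0" "v t\<^sub>c = 0" "p\<^sub>1 t\<^sub>c = 0" "p\<^sub>2 t\<^sub>c = 0"
      by auto
    \<comment> \<open>The nonsingular side is shortened to the given neighborhood, keeping
      \<open>t\<^sub>c\<close> as an endpoint. The discontinuity found is different from
      \<open>t\<^sub>c\<close>, as both the limit point and the failure of analyticity
      demand.\<close>
    have disc: "\<exists>s. control_discontinuous_at u s \<and> (s \<in> {r<..<t\<^sub>c} \<or> s \<in> {t\<^sub>c<..<r'})"
      if "r < t\<^sub>c" "t\<^sub>c < r'" for r r'
      using arcs
    proof
      assume "singular_on ?\<phi> {\<alpha><..<t\<^sub>c} \<and> nonsingular_on ?\<phi> {t\<^sub>c<..<\<beta>}"
      then have "nonsingular_on ?\<phi> {t\<^sub>c<..<min r' \<beta>}"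
        unfolding nonsingular_on_def by (auto elim!: eventually_mono)
      then have "\<exists>s\<in>{t\<^sub>c<..<min r' \<beta>}. control_discontinuous_at u s"
        by (rule nonsingular[OF _ _ _ _ l _ zero, rotated 3])
          (use \<alpha>\<beta> that in \<open>simp_all add: min_le_iff_disj\<close>)
      then show ?thesis
        by auto
    next
      assume "nonsingular_on ?\<phi> {\<alpha><..<t\<^sub>c} \<and> singular_on ?\<phi> {t\<^sub>c<..<\<beta>}"
      then have "nonsingular_on ?\<phi> {max r \<alpha><..<t\<^sub>c}"
        unfolding nonsingular_on_def by (auto elim!: eventually_mono)
      then have "\<exists>s\<in>{max r \<alpha><..<t\<^sub>c}. control_discontinuous_at u s"
        by (rule nonsingular[OF _ _ _ _ l _ zero, rotated 3])
          (use \<alpha>\<beta> that in \<open>simp_all add: le_max_iff_disj\<close>)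
      then show ?thesis
        by auto
    qed
    have isCont: "isCont x t\<^sub>c" "isCont p\<^sub>2 t\<^sub>c"
      using cont(1,4) \<alpha>\<beta> by (auto intro!: continuous_on_interior)
    have "junction_order T M Q c l (\<lambda>t. (x t, v t, p\<^sub>1 t, p\<^sub>2 t)) t\<^sub>c 2"
      by (rule junction_order_2) (fact T Q c isCont zero l hess M)+
    moreover have "\<not> analytic_junction u t\<^sub>c"
    proof
      assume "analytic_junction u t\<^sub>c"
      then obtain \<epsilon> w where "\<epsilon> > 0" and wu: "AE t\<in>{t\<^sub>c - \<epsilon><..<t\<^sub>c + \<epsilon>} in lebesgue. w t = u t"
        and "piecewise_analytic w (t\<^sub>c - \<epsilon>) (t\<^sub>c + \<epsilon>)"
        unfolding analytic_junction_def by blast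
      then obtain r r' where r: "r \<in> {t\<^sub>c - \<epsilon><..<t\<^sub>c}" "r' \<in> {t\<^sub>c<..<t\<^sub>c + \<epsilon>}"
        "real_analytic_on w {r<..<t\<^sub>c}" "real_analytic_on w {t\<^sub>c<..<r'}"
        unfolding piecewise_analytic_def by force
      from disc[of r r'] r obtain s where s: "control_discontinuous_at u s" "s \<in> {r<..<t\<^sub>c} \<or> s \<in> {t\<^sub>c<..<r'}"
        by auto
      then have "isCont w s"
        using real_analytic_on_imp_isCont r(3,4) by blast
      moreover have "s \<in> {t\<^sub>c - \<epsilon><..<t\<^sub>c + \<epsilon>}"
        using s(2) r(1,2) by auto
      \<comment> \<open>Discontinuity at \<open>s\<close> is refuted on an interval centered at
        \<open>s\<close>, which must fit where the analytic version agrees with \<open>u\<close>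
        almost everywhere.\<close>
      then obtain \<delta> where \<delta>: "\<delta> > 0" "{s - \<delta><..<s + \<delta>} \<subseteq> {t\<^sub>c - \<epsilon><..<t\<^sub>c + \<epsilon>}"
        by (intro that[of "min (s - (t\<^sub>c - \<epsilon>)) (t\<^sub>c + \<epsilon> - s)"]) auto
      ultimately show False
        using s(1) AE_subset[OF wu \<delta>(2)] unfolding control_discontinuous_at_def by blast
    qed
    moreover have "fuller_phenomenon u t\<^sub>c"
      unfolding fuller_phenomenon_def islimpt_approachable
    proof (intro allI impI)
      fix e :: real assume "e > 0"
      with disc[of "t\<^sub>c - e" "t\<^sub>c + e"] obtain s where
        s: "control_discontinuous_at u s" "s \<in> {t\<^sub>c - e<..<t\<^sub>c} \<or> s \<in> {t\<^sub>c<..<t\<^sub>c + e}"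
        by auto
      then show "\<exists>s\<in>{s. control_discontinuous_at u s}. s \<noteq> t\<^sub>c \<and> dist s t\<^sub>c < e"
        by (intro bexI[of _ s]) (auto simp: dist_real_def)
    qed
    ultimately show ?thesis
      by blast
  qed
  from part_i part_ii show ?thesis
    by blast
qed

end
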